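(* Let $\mathbb{X}$ be a homogeneous oligomorphic graph. Isomorphism classes of finite subgraphs of $\mathbb{X}\times\mathbb{Q}$ correspond bijectively to finite sequences $([\mathsf{x}_1],\dots,[\mathsf{x}_l])$, $l\ge 0$, of isomorphism classes of finite non-empty subgraphs $\mathsf{x}_1,\dots,\mathsf{x}_l$ of $\mathbb{X}$, the sequence corresponding to the class of the graph $(\mathsf{x}_1,\dots,\mathsf{x}_l)$ described in the context. Moreover, if $k$ is a field and $\mathbb{X}$ admits an R-measure $\nu$ with values in $k$, then $\mathbb{X}\times\mathbb{Q}$ admits an R-measure $\nu_{\mathbb{Q}}$ with values in $k$ which assigns to $(\mathsf{x}_1,\dots,\mathsf{x}_l)$ the value $$\nu_{\mathbb{Q}}(\mathsf{x}_1,\dots,\mathsf{x}_l)=(-1)^l\prod_{i=1}^{l}\nu(\mathsf{x}_i).$$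
   Context: Graphs. For a set $I$, a graph ($I$-multi-relational graph) $\mathbb{X}$ is a set $X$ of vertices with subsets $E_i\subseteq X^2$ ($i\in I$) of $i$-edges (loops allowed). Subgraph always means induced subgraph: $X'\subseteq X$ with $i$-edges $E_i\cap (X')^2$. An embedding is an injective map of vertices which preserves $i$-edges and $i$-non-edges for all $i\in I$; an isomorphism is a bijective embedding. $\mathrm{age}(\mathbb{X})$ is the class of finite graphs (with the same $I$) which embed into $\mathbb{X}$; it contains the empty graph $\emptyset$. $\mathbb{X}$ is homogeneous if every isomorphism between finite subgraphs of $\mathbb{X}$ extends to an automorphism of $\mathbb{X}$. It is homogeneous oligomorphic if moreover for each $n\ge 0$ it has only finitely many isomorphism classes of $n$-element subgraphs. The graph $\mathbb{X}\times\mathbb{Q}$. It has index set $I\sqcup\{*\}$, vertex set $X\times\mathbb{Q}$, $i$-edges $\{((x_1,y),(x_2,y))\mid (x_1,x_2)\in E_i,\ y\in\mathbb{Q}\}$ for $i\in I$, and $*$-edges $\{((x_1,y_1),(x_2,y_2))\mid x_1,x_2\in X,\ y_1<y_2\}$. It is again homogeneous oligomorphic. For finite non-empty $\mathsf{x}_1,\dots,\mathsf{x}_l\in\mathrm{age}(\mathbb{X})$, the graph $(\mathsf{x}_1,\dots,\mathsf{x}_l)$ has as vertices the disjoint union of the vertices of the $\mathsf{x}_a$, as $i$-edges ($i\in I$) the union of the $i$-edges of the $\mathsf{x}_a$, and a $*$-edge from each vertex of $\mathsf{x}_a$ to each vertex of $\mathsf{x}_b$ exactly when $a<b$. Amalgamations.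 Let $\iota_1\colon\mathsf{x}_0\hookrightarrow\mathsf{x}_1$, $\iota_2\colon\mathsf{x}_0\hookrightarrow\mathsf{x}_2$ be embeddings between graphs in $\mathrm{age}(\mathbb{X})$. An amalgamation of $(\iota_1,\iota_2)$ is a graph $\mathsf{a}\in\mathrm{age}(\mathbb{X})$ with embeddings $j_1\colon\mathsf{x}_1\hookrightarrow\mathsf{a}$, $j_2\colon\mathsf{x}_2\hookrightarrow\mathsf{a}$ such that $j_1\iota_1=j_2\iota_2$ and $j_1,j_2$ are jointly surjective on vertices. An isomorphism of amalgamations $(\mathsf{a},j_1,j_2)\to(\mathsf{a}',j_1',j_2')$ is a graph isomorphism $\varphi\colon\mathsf{a}\to\mathsf{a}'$ with $\varphi j_1=j_1'$, $\varphi j_2=j_2'$. For a homogeneous oligomorphic graph there are finitely many isomorphism classes of amalgamations of any $(\iota_1,\iota_2)$. R-measures. An R-measure for a homogeneous oligomorphic graph $\mathbb{X}$ with values in a field $k$ assigns to each $\mathsf{x}\in\mathrm{age}(\mathbb{X})$ an element $\nu(\mathsf{x})\in k\setminus\{0\}$ such that: (1) $\nu(\mathsf{x}_1)=\nu(\mathsf{x}_2)$ if $\mathsf{x}_1\cong\mathsf{x}_2$; (2) $\nu(\emptyset)=1$; (3) for all embeddings $\iota_1\colon\mathsf{x}_0\hookrightarrow\mathsf{x}_1$, $\iota_2\colon\mathsf{x}_0\hookrightarrow\mathsf{x}_2$ in $\mathrm{age}(\mathbb{X})$, if $\mathsf{a}_1,\dots,\mathsf{a}_r$ represent all isomorphism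 classes of amalgamations of $(\iota_1,\iota_2)$, then $\nu(\mathsf{x}_1)\nu(\mathsf{x}_2)=\nu(\mathsf{x}_0)\sum_{i=1}^r\nu(\mathsf{a}_i)$. *)

theory Defs
  imports Complex_Main
begin

text \<open>
  The index set is a component of the graph, so that it may be empty or a proper subset of
  the type \<open>'i\<close>. Values \<open>edges G i\<close> with \<open>i \<notin> idx G\<close> carry no meaning
  and are ignored by every notion below.
\<close>

record ('v, 'i) mgraph =
  verts :: "'v set"
  idx :: "'i set"
  edges :: "'i \<Rightarrow> ('v \<times> 'v) set"

definition wf_mgraph :: "('v, 'i) mgraph \<Rightarrow> bool" where
  "wf_mgraph G \<longleftrightarrow> (\<forall>i\<in>idx G. edges G i \<subseteq> verts G \<times> verts G)"

definition induced :: "('v, 'i) mgraph \<Rightarrow> 'v set \<Rightarrow> ('v, 'i) mgraph" where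
  "induced G S = \<lparr>verts = S, idx = idx G, edges = (\<lambda>i. edges G i \<inter> S \<times> S)\<rparr>"

definition fin_subgraphs :: "('v, 'i) mgraph \<Rightarrow> ('v, 'i) mgraph set" where
  "fin_subgraphs G = {induced G S | S. finite S \<and> S \<subseteq> verts G}"

definition embedding :: "('v, 'i) mgraph \<Rightarrow> ('w, 'i) mgraph \<Rightarrow> ('v \<Rightarrow> 'w) \<Rightarrow> bool" where
  "embedding G H f \<longleftrightarrow>
     idx G = idx H \<and> inj_on f (verts G) \<and> f ` verts G \<subseteq> verts H \<and>
     (\<forall>i\<in>idx G. \<forall>u\<in>verts G. \<forall>v\<in>verts G. (u, v) \<in> edges G i \<longleftrightarrow> (f u, f v) \<in> edges H i)"

definition isomorphism :: "('v, 'i) mgraph \<Rightarrow> ('w, 'i) mgraph \<Rightarrow> ('v \<Rightarrow> 'w) \<Rightarrow> bool" where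
  "isomorphism G H f \<longleftrightarrow> embedding G H f \<and> f ` verts G = verts H"

definition isomorphic :: "('v, 'i) mgraph \<Rightarrow> ('w, 'i) mgraph \<Rightarrow> bool" where
  "isomorphic G H \<longleftrightarrow> (\<exists>f. isomorphism G H f)"

text \<open>
  The class, among the finite subgraphs of \<open>X\<close>, of a graph \<open>G\<close> which itself need not be a
  subgraph of \<open>X\<close> (nor have the same vertex type).
\<close>

definition iso_class :: "('v, 'i) mgraph \<Rightarrow> ('w, 'i) mgraph \<Rightarrow> ('v, 'i) mgraph set" where
  "iso_class X G = {H \<in> fin_subgraphs X. isomorphic H G}"

definition homogeneous :: "('v, 'i) mgraph \<Rightarrow> bool" where
  "homogeneous X \<longleftrightarrow>
     (\<forall>G\<in>fin_subgraphs X. \<forall>H\<in>fin_subgraphs X. \<forall>f. isomorphism G H f \<longrightarrow>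
        (\<exists>g. isomorphism X X g \<and> (\<forall>v\<in>verts G. g v = f v)))"

definition homogeneous_oligomorphic :: "('v, 'i) mgraph \<Rightarrow> bool" where
  "homogeneous_oligomorphic X \<longleftrightarrow>
     wf_mgraph X \<and> homogeneous X \<and>
     (\<forall>n. finite (iso_class X ` {G \<in> fin_subgraphs X. card (verts G) = n}))"

text \<open>
  Every finite graph has an isomorphic copy with vertices in \<^typ>\<open>nat\<close>, so these copies
  stand for the whole class of finite graphs embedding into \<open>X\<close>.
\<close>

definition age :: "('v, 'i) mgraph \<Rightarrow> (nat, 'i) mgraph set" where
  "age X = {G. wf_mgraph G \<and> finite (verts G) \<and> (\<exists>f. embedding G X f)}"

definition times_rat :: "('v, 'i) mgraph \<Rightarrow> ('v \<times> rat, 'i option) mgraph" where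
  "times_rat X =
     \<lparr>verts = verts X \<times> UNIV,
      idx = insert None (Some ` idx X),
      edges = (\<lambda>j. case j of
          None \<Rightarrow> {((x1, y1), (x2, y2)) | x1 y1 x2 y2. x1 \<in> verts X \<and> x2 \<in> verts X \<and> y1 < y2}
        | Some i \<Rightarrow> {((x1, y), (x2, y)) | x1 x2 y. (x1, x2) \<in> edges X i})\<rparr>"

text \<open>
  The graph \<open>(x\<^sub>1, \<dots>, x\<^sub>l)\<close>, on the disjoint union of the vertex sets. The index set is an
  argument because an empty list of graphs does not determine it.
\<close>

definition seq_graph :: "'i set \<Rightarrow> ('v, 'i) mgraph list \<Rightarrow> (nat \<times> 'v, 'i option) mgraph" where
  "seq_graph I xs =
     (let V = {(a, v). a < length xs \<and> v \<in> verts (xs ! a)} in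
     \<lparr>verts = V,
      idx = insert None (Some ` I),
      edges = (\<lambda>j. case j of
          None \<Rightarrow> {((a, u), (b, v)) | a u b v. (a, u) \<in> V \<and> (b, v) \<in> V \<and> a < b}
        | Some i \<Rightarrow> {((a, u), (a, v)) | a u v. a < length xs \<and> (u, v) \<in> edges (xs ! a) i})\<rparr>)"

type_synonym 'i amalg = "(nat, 'i) mgraph \<times> (nat \<Rightarrow> nat) \<times> (nat \<Rightarrow> nat)"

definition amalgamations ::
  "('v, 'i) mgraph \<Rightarrow> (nat, 'i) mgraph \<Rightarrow> (nat, 'i) mgraph \<Rightarrow> (nat, 'i) mgraph \<Rightarrow>
   (nat \<Rightarrow> nat) \<Rightarrow> (nat \<Rightarrow> nat) \<Rightarrow> 'i amalg set" where
  "amalgamations X x0 x1 x2 \<iota>1 \<iota>2 =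
     {(a, j1, j2). a \<in> age X \<and> embedding x1 a j1 \<and> embedding x2 a j2 \<and>
        (\<forall>v\<in>verts x0. j1 (\<iota>1 v) = j2 (\<iota>2 v)) \<and>
        j1 ` verts x1 \<union> j2 ` verts x2 = verts a}"

definition amalg_isomorphic ::
  "(nat, 'i) mgraph \<Rightarrow> (nat, 'i) mgraph \<Rightarrow> 'i amalg \<Rightarrow> 'i amalg \<Rightarrow> bool" where
  "amalg_isomorphic x1 x2 = (\<lambda>(a, j1, j2) (a', j1', j2').
     \<exists>\<phi>. isomorphism a a' \<phi> \<and>
       (\<forall>v\<in>verts x1. \<phi> (j1 v) = j1' v) \<and> (\<forall>v\<in>verts x2. \<phi> (j2 v) = j2' v))"

definition amalg_representatives ::
  "('v, 'i) mgraph \<Rightarrow> (nat, 'i) mgraph \<Rightarrow> (nat, 'i) mgraph \<Rightarrow> (nat, 'i) mgraph \<Rightarrow>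
   (nat \<Rightarrow> nat) \<Rightarrow> (nat \<Rightarrow> nat) \<Rightarrow> 'i amalg set \<Rightarrow> bool" where
  "amalg_representatives X x0 x1 x2 \<iota>1 \<iota>2 A \<longleftrightarrow>
     finite A \<and> A \<subseteq> amalgamations X x0 x1 x2 \<iota>1 \<iota>2 \<and>
     (\<forall>b\<in>amalgamations X x0 x1 x2 \<iota>1 \<iota>2. \<exists>!a. a \<in> A \<and> amalg_isomorphic x1 x2 a b)"

text \<open>
  R-measures only make sense for homogeneous oligomorphic graphs, where every pair of
  embeddings has a finite set of representatives; hence the first conjunct. The function
  \<open>\<nu>\<close> is unconstrained outside \<open>age X\<close>.
\<close>

definition R_measure :: "('v, 'i) mgraph \<Rightarrow> ((nat, 'i) mgraph \<Rightarrow> 'k::field) \<Rightarrow> bool" where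
  "R_measure X \<nu> \<longleftrightarrow>
     homogeneous_oligomorphic X \<and>
     (\<forall>x\<in>age X. \<nu> x \<noteq> 0) \<and>
     (\<forall>x1\<in>age X. \<forall>x2\<in>age X. isomorphic x1 x2 \<longrightarrow> \<nu> x1 = \<nu> x2) \<and>
     (\<forall>x\<in>age X. verts x = {} \<longrightarrow> \<nu> x = 1) \<and>
     (\<forall>x0\<in>age X. \<forall>x1\<in>age X. \<forall>x2\<in>age X. \<forall>\<iota>1 \<iota>2 A.
        embedding x0 x1 \<iota>1 \<longrightarrow> embedding x0 x2 \<iota>2 \<longrightarrow>
        amalg_representatives X x0 x1 x2 \<iota>1 \<iota>2 A \<longrightarrow>
        \<nu> x1 * \<nu> x2 = \<nu> x0 * (\<Sum>(a, j1, j2)\<in>A. \<nu> a))"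

end

(* By homogeneity an R-measure on Y amounts to an Aut(Y)-invariant function m on the finite subsets
   of Y, and building amalgamations one point at a time reduces the amalgamation axiom to one-point
   extensions: for S0 <= S and a point p, the sum of m(S + q) over the Aut(Y)_S-orbits of points q in
   the Aut(Y)_S0-orbit of p equals m(S) m(S0 + p) / m(S0). On X x Q put
   m_Q(T) = product of -m(T_y) over the levels y of T, and let p = (x, y). If y is a level of S0, every
   q lies on that level and the law is the law of X. Otherwise q lies either on one of the n levels of
   S in the interval around y left open by S0, each contributing m_Q(S) m(x) by the law of X over the
   empty set, or in one of the n + 1 gaps between these levels, each contributing - m_Q(S) m(x). The
   total is - m_Q(S) m(x) = m_Q(S) m_Q(S0 + p) / m_Q(S0). *)

theory Submission
  imports Defs "HOL-Library.FuncSet"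
begin

text \<open>Amalgamating two finite subgraphs of the product in one go would mean summing over all
  ways to interleave two chains of levels, merging some of them and amalgamating inside
  \<open>X\<close>. With a single new point only one height is undecided, and the sign makes the
  count close: -1 is the Euler characteristic of an open interval, however it is cut, and also the
  factor brought by a new level. The automorphisms of the product are exactly the increasing
  bijections of the rationals combined with an independent automorphism of \<open>X\<close> on each
  level. Hence the orbit of a point under a pointwise stabilizer is a position of its height
  together with an orbit in \<open>X\<close>. Amalgamations in the axiom are graphs on natural
  numbers up to isomorphism; homogeneity turns them into double cosets of pointwise stabilizers. The
  axiom concerns every set of representatives, so the sum must be shown independent of the choice
  before one convenient transversal can decide it. Passing from one point to many cancels values of
  the measure, which is where their being non-zero enters.\<close>

section \<open>Embeddings, isomorphisms and induced subgraphs\<close>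

lemma embedding_idx: "embedding G H f \<Longrightarrow> idx G = idx H"
  by (simp add: embedding_def)

lemma embedding_inj: "embedding G H f \<Longrightarrow> inj_on f (verts G)"
  by (simp add: embedding_def)

lemma embedding_in: "embedding G H f \<Longrightarrow> v \<in> verts G \<Longrightarrow> f v \<in> verts H"
  by (auto simp: embedding_def)

lemma embedding_image: "embedding G H f \<Longrightarrow> f ` verts G \<subseteq> verts H"
  by (simp add: embedding_def)

lemma embedding_edges:
  "embedding G H f \<Longrightarrow> i \<in> idx G \<Longrightarrow> u \<in> verts G \<Longrightarrow> v \<in> verts G \<Longrightarrow>
     (f u, f v) \<in> edges H i \<longleftrightarrow> (u, v) \<in> edges G i"
  by (auto simp: embedding_def)

lemma isomorphism_embedding: "isomorphism G H f \<Longrightarrow> embedding G H f"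
  by (simp add: isomorphism_def)

lemma isomorphism_image: "isomorphism G H f \<Longrightarrow> f ` verts G = verts H"
  by (simp add: isomorphism_def)

lemma embedding_comp: "embedding G H f \<Longrightarrow> embedding H K g \<Longrightarrow> embedding G K (\<lambda>v. g (f v))"
  unfolding embedding_def inj_on_def by (auto simp: image_subset_iff)

lemma isomorphism_comp:
  assumes "isomorphism G H f" "isomorphism H K g" shows "isomorphism G K (\<lambda>v. g (f v))"
proof -
  have "(\<lambda>v. g (f v)) ` verts G = g ` (f ` verts G)" by auto
  then show ?thesis
    using assms embedding_comp[of G H f K g] by (auto simp: isomorphism_def)
qed

lemma isomorphism_id: "isomorphism G G (\<lambda>v. v)"
  by (simp add: isomorphism_def embedding_def)

lemma isomorphism_inv:
  assumes "isomorphism G H f" shows "isomorphism H G (inv_into (verts G) f)"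
proof -
  have im: "f ` verts G = verts H" and inj: "inj_on f (verts G)" and idx: "idx G = idx H"
    using assms by (auto simp: isomorphism_def embedding_def)
  have bij: "bij_betw f (verts G) (verts H)" using im inj by (simp add: bij_betw_def)
  have ibij: "bij_betw (inv_into (verts G) f) (verts H) (verts G)"
    using bij by (rule bij_betw_inv_into)
  have fi: "f (inv_into (verts G) f v) = v" if "v \<in> verts H" for v
    using that im by (simp add: f_inv_into_f)
  have ii: "inv_into (verts G) f v \<in> verts G" if "v \<in> verts H" for v
    using that im by (simp add: inv_into_into)
  have "(u, v) \<in> edges H i \<longleftrightarrow> (inv_into (verts G) f u, inv_into (verts G) f v) \<in> edges G i"
    if "i \<in> idx H" "u \<in> verts H" "v \<in> verts H" for i u v
    using embedding_edges[OF isomorphism_embedding[OF assms], of i] that fi ii idx by metis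
  then show ?thesis
    using ibij idx by (auto simp: isomorphism_def embedding_def bij_betw_def)
qed

lemma isomorphic_refl: "isomorphic G G"
  using isomorphism_id by (auto simp: isomorphic_def)

lemma isomorphic_sym: "isomorphic G H \<Longrightarrow> isomorphic H G"
  using isomorphism_inv by (auto simp: isomorphic_def)

lemma isomorphic_trans: "isomorphic G H \<Longrightarrow> isomorphic H K \<Longrightarrow> isomorphic G K"
  unfolding isomorphic_def by (blast intro: isomorphism_comp)

lemma verts_induced [simp]: "verts (induced G S) = S"
  and idx_induced [simp]: "idx (induced G S) = idx G"
  and edges_induced [simp]: "edges (induced G S) i = edges G i \<inter> S \<times> S"
  by (simp_all add: induced_def)

lemma embedding_induced_iff:
  "S \<subseteq> verts H \<Longrightarrow> embedding G (induced H S) f \<longleftrightarrow> embedding G H f \<and> f ` verts G \<subseteq> S"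
  unfolding embedding_def by (auto simp: image_subset_iff)

lemma embedding_induced_dom:
  "embedding G H f \<Longrightarrow> S \<subseteq> verts G \<Longrightarrow> embedding (induced G S) H f"
  unfolding embedding_def by (auto intro: inj_on_subset simp: subset_iff)

lemma isomorphism_induced_iff:
  "S \<subseteq> verts H \<Longrightarrow> isomorphism G (induced H S) f \<longleftrightarrow> embedding G H f \<and> f ` verts G = S"
  by (auto simp: isomorphism_def embedding_induced_iff)

lemma embedding_incl: "S \<subseteq> verts G \<Longrightarrow> embedding (induced G S) G (\<lambda>v. v)"
  by (auto simp: embedding_def)

lemma isomorphic_induced_image:
  "embedding G H f \<Longrightarrow> isomorphic G (induced H (f ` verts G))"
  by (auto simp: isomorphic_def isomorphism_induced_iff embedding_image)

lemma embedding_isomorphic_image: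
  assumes e: "embedding G Y e" and e': "embedding G Y e'"
  obtains \<phi> where "isomorphism (induced Y (e ` verts G)) (induced Y (e' ` verts G)) \<phi>"
    and "\<And>v. v \<in> verts G \<Longrightarrow> \<phi> (e v) = e' v"
proof
  let ?i = "inv_into (verts G) e"
  have "isomorphism G (induced Y (e ` verts G)) e" "isomorphism G (induced Y (e' ` verts G)) e'"
    using e e' by (auto simp: isomorphism_induced_iff embedding_image)
  then show "isomorphism (induced Y (e ` verts G)) (induced Y (e' ` verts G)) (\<lambda>v. e' (?i v))"
    using isomorphism_inv isomorphism_comp by blast
  show "e' (?i (e v)) = e' v" if "v \<in> verts G" for v
    using that e by (simp add: embedding_inj)
qed

lemma fin_subgraphsI: "finite S \<Longrightarrow> S \<subseteq> verts G \<Longrightarrow> induced G S \<in> fin_subgraphs G"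
  by (auto simp: fin_subgraphs_def)

lemma fin_subgraphsD:
  assumes "H \<in> fin_subgraphs G"
  shows "finite (verts H)" "verts H \<subseteq> verts G" "H = induced G (verts H)" "idx H = idx G"
    "embedding H G (\<lambda>v. v)"
  using assms by (auto simp: fin_subgraphs_def embedding_incl)

text \<open>Both images are finite subgraphs, and matching them vertex by vertex is an isomorphism
  to which homogeneity applies. This form, for an abstract graph \<open>G\<close>, lets values on
  the age be read as values on vertex sets up to automorphism.\<close>

lemma homogeneous_extend:
  assumes "homogeneous Y" "finite (verts G)" "embedding G Y e" "embedding G Y e'"
  obtains g where "isomorphism Y Y g" "\<And>v. v \<in> verts G \<Longrightarrow> g (e v) = e' v"
proof -
  obtain \<phi> where \<phi>: "isomorphism (induced Y (e ` verts G)) (induced Y (e' ` verts G)) \<phi>"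
    "\<And>v. v \<in> verts G \<Longrightarrow> \<phi> (e v) = e' v"
    using embedding_isomorphic_image assms(3,4) by blast
  have fin: "induced Y (e ` verts G) \<in> fin_subgraphs Y" "induced Y (e' ` verts G) \<in> fin_subgraphs Y"
    using assms by (auto intro!: fin_subgraphsI simp: embedding_in)
  then obtain g where "isomorphism Y Y g" "\<forall>v\<in>e ` verts G. g v = \<phi> v"
    using assms(1)[unfolded homogeneous_def, rule_format, OF fin \<phi>(1)] by auto
  then show thesis using \<phi>(2) by (intro that[of g]) auto
qed

lemma iso_class_eqI: "isomorphic G H \<Longrightarrow> iso_class X G = iso_class X H"
  unfolding iso_class_def using isomorphic_trans[of _ G H] isomorphic_trans[of _ H G] isomorphic_sym[of G H]
  by blast

text \<open>Equality of classes says nothing when both are empty, so a member \<open>K\<close>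
  serves as a bridge between \<open>G\<close> and \<open>H\<close>.\<close>

lemma iso_class_eqD:
  "iso_class X G = iso_class X H \<Longrightarrow> K \<in> fin_subgraphs X \<Longrightarrow> isomorphic K G \<Longrightarrow> isomorphic G H"
  unfolding iso_class_def using isomorphic_trans[of G K H] isomorphic_sym[of K G] by blast

subsection \<open>Automorphisms and transversals of their orbits\<close>

text \<open>The pointwise stabilizer of \<open>S\<close>. For \<open>S\<close> inside
  \<open>verts Y\<close> its members are constrained only on \<open>verts Y\<close>, so inverses are
  meaningful only there; this explains the form of \<open>auts_inv\<close>.\<close>

definition auts :: "('v, 'i) mgraph \<Rightarrow> 'v set \<Rightarrow> ('v \<Rightarrow> 'v) set" where
  "auts Y S = {g. isomorphism Y Y g \<and> (\<forall>s\<in>S. g s = s)}"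

lemma autsD:
  assumes "g \<in> auts Y S"
  shows "isomorphism Y Y g" "\<And>s. s \<in> S \<Longrightarrow> g s = s" "\<And>v. v \<in> verts Y \<Longrightarrow> g v \<in> verts Y"
    "inj_on g (verts Y)"
  using assms by (auto simp: auts_def isomorphism_def embedding_in embedding_inj)

lemma auts_id: "(\<lambda>v. v) \<in> auts Y S"
  by (simp add: auts_def isomorphism_id)

lemma auts_comp: "f \<in> auts Y S \<Longrightarrow> g \<in> auts Y S \<Longrightarrow> (\<lambda>v. g (f v)) \<in> auts Y S"
  by (auto simp: auts_def isomorphism_comp)

lemma auts_mono: "S \<subseteq> T \<Longrightarrow> auts Y T \<subseteq> auts Y S"
  by (auto simp: auts_def)

lemma auts_inv:
  assumes "g \<in> auts Y S" "S \<subseteq> verts Y"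
  obtains h where "h \<in> auts Y S" "\<And>v. v \<in> verts Y \<Longrightarrow> h (g v) = v"
    "\<And>v. v \<in> verts Y \<Longrightarrow> g (h v) = v"
proof
  let ?h = "inv_into (verts Y) g"
  note g = autsD[OF assms(1)]
  show hg: "?h (g v) = v" if "v \<in> verts Y" for v
    using that g(4) by simp
  show "g (?h v) = v" if "v \<in> verts Y" for v
    using that isomorphism_image[OF g(1)] by (simp add: f_inv_into_f)
  show "?h \<in> auts Y S"
  proof -
    have "?h s = s" if "s \<in> S" for s using hg[of s] g(2)[OF that] assms(2) that by auto
    then show ?thesis by (simp add: auts_def isomorphism_inv[OF g(1)])
  qed
qed

definition point_rel :: "('v, 'i) mgraph \<Rightarrow> 'v set \<Rightarrow> 'v \<Rightarrow> 'v \<Rightarrow> bool" where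
  "point_rel Y S p q \<longleftrightarrow> (\<exists>g\<in>auts Y S. g p = q)"

text \<open>For automorphisms this is equality of double cosets of the stabilizers of
  \<open>S\<close> and \<open>P\<close>: two automorphisms that agree on \<open>P\<close> differ by
  one fixing \<open>P\<close>.\<close>

definition coset_rel :: "('v, 'i) mgraph \<Rightarrow> 'v set \<Rightarrow> 'v set \<Rightarrow> ('v \<Rightarrow> 'v) \<Rightarrow> ('v \<Rightarrow> 'v) \<Rightarrow> bool" where
  "coset_rel Y S P g g' \<longleftrightarrow> (\<exists>k\<in>auts Y S. \<forall>p\<in>P. k (g p) = g' p)"

lemma coset_rel_sym:
  assumes "coset_rel Y S P g g'" "S \<subseteq> verts Y" "g ` P \<subseteq> verts Y"
  shows "coset_rel Y S P g' g"
proof -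
  obtain k where k: "k \<in> auts Y S" "\<forall>p\<in>P. k (g p) = g' p"
    using assms(1) by (auto simp: coset_rel_def)
  obtain h where "h \<in> auts Y S" "\<And>v. v \<in> verts Y \<Longrightarrow> h (k v) = v"
    using auts_inv[OF k(1) assms(2)] by metis
  then show ?thesis unfolding coset_rel_def
    using k(2) assms(3) by (metis image_subset_iff)
qed

lemma coset_rel_refl: "coset_rel Y S P g g"
  unfolding coset_rel_def by (rule bexI[OF _ auts_id]) simp

lemma coset_rel_trans:
  "coset_rel Y S P f g \<Longrightarrow> coset_rel Y S P g h \<Longrightarrow> coset_rel Y S P f h"
  unfolding coset_rel_def by (metis auts_comp)

lemma point_rel_trans: "point_rel Y S p q \<Longrightarrow> point_rel Y S q r \<Longrightarrow> point_rel Y S p r"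
  unfolding point_rel_def by (metis auts_comp)

lemma point_rel_refl: "point_rel Y S p p"
  unfolding point_rel_def using auts_id by metis

lemma point_rel_sym:
  assumes "point_rel Y S p q" "S \<subseteq> verts Y" "p \<in> verts Y" shows "point_rel Y S q p"
proof -
  obtain g where g: "g \<in> auts Y S" "g p = q" using assms(1) by (auto simp: point_rel_def)
  obtain h where "h \<in> auts Y S" "\<And>v. v \<in> verts Y \<Longrightarrow> h (g v) = v"
    using auts_inv[OF g(1) assms(2)] by metis
  then show ?thesis using g(2) assms(3) by (auto simp: point_rel_def)
qed

lemma point_rel_in: "point_rel Y S p q \<Longrightarrow> p \<in> verts Y \<Longrightarrow> q \<in> verts Y"
  unfolding point_rel_def using autsD(3) by metis

section \<open>Systems of representatives and sums over them\<close>

definition transversal :: "('a \<Rightarrow> 'a \<Rightarrow> bool) \<Rightarrow> 'a set \<Rightarrow> 'a set \<Rightarrow> bool" where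
  "transversal R E A \<longleftrightarrow> finite A \<and> A \<subseteq> E \<and> (\<forall>e\<in>E. \<exists>!a. a \<in> A \<and> R a e)"

text \<open>Matching each member of \<open>A\<close> with the member of \<open>B\<close> in its
  class is a bijection that preserves \<open>w\<close>. The amalgamation axiom ranges over every set
  of representatives; this is why a single one decides it.\<close>

lemma transversal_sum_eq:
  assumes A: "transversal R E A" and B: "transversal R E B"
    and sym: "\<And>x y. x \<in> E \<Longrightarrow> y \<in> E \<Longrightarrow> R x y \<Longrightarrow> R y x"
    and w: "\<And>x y. x \<in> E \<Longrightarrow> y \<in> E \<Longrightarrow> R x y \<Longrightarrow> w x = w y"
  shows "sum w A = sum w B"
proof -
  have AE: "A \<subseteq> E" and BE: "B \<subseteq> E" using A B by (auto simp: transversal_def)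
  have "\<forall>a\<in>A. \<exists>b. b \<in> B \<and> R b a" "\<forall>b\<in>B. \<exists>a. a \<in> A \<and> R a b"
    using A B AE BE unfolding transversal_def by blast+
  then obtain f g where f: "\<And>a. a \<in> A \<Longrightarrow> f a \<in> B \<and> R (f a) a"
    and g: "\<And>b. b \<in> B \<Longrightarrow> g b \<in> A \<and> R (g b) b" by metis
  have gf: "g (f a) = a" if a: "a \<in> A" for a
  proof -
    have "R a (f a)" "R (g (f a)) (f a)" "f a \<in> E" "g (f a) \<in> A"
      using f[OF a] g[of "f a"] sym[of "f a" a] a AE BE by auto
    then show ?thesis using A a unfolding transversal_def by blast
  qed
  have fg: "f (g b) = b" if b: "b \<in> B" for b
  proof -
    have "R b (g b)" "R (f (g b)) (g b)" "g b \<in> E" "f (g b) \<in> B"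
      using g[OF b] f[of "g b"] sym[of "g b" b] b AE BE by auto
    then show ?thesis using B b unfolding transversal_def by blast
  qed
  show ?thesis
  proof (rule sum.reindex_bij_witness[of _ g f])
    show "w (f a) = w a" if "a \<in> A" for a using w[of "f a" a] f that AE BE by auto
  qed (use f g gf fg in auto)
qed

text \<open>\<open>h\<close> respects and reflects the relations and meets every class, so it is a
  bijection on classes. Its two uses send automorphisms to amalgamations and automorphisms to images
  of a point.\<close>

lemma transversal_image:
  assumes A: "transversal R E A"
    and h: "h ` E \<subseteq> E'" and R: "\<And>x y. x \<in> E \<Longrightarrow> y \<in> E \<Longrightarrow> R x y \<longleftrightarrow> R' (h x) (h y)"
    and surj: "\<And>z. z \<in> E' \<Longrightarrow> \<exists>x\<in>E. R' (h x) z"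
    and sym: "\<And>x y. x \<in> E' \<Longrightarrow> y \<in> E' \<Longrightarrow> R' x y \<Longrightarrow> R' y x"
    and trans: "\<And>x y z. x \<in> E' \<Longrightarrow> y \<in> E' \<Longrightarrow> z \<in> E' \<Longrightarrow> R' x y \<Longrightarrow> R' y z \<Longrightarrow> R' x z"
  shows "transversal R' E' (h ` A)" "inj_on h A"
proof -
  have AE: "A \<subseteq> E" and fin: "finite A" and ex1: "\<And>e. e \<in> E \<Longrightarrow> \<exists>!a. a \<in> A \<and> R a e"
    using A by (auto simp: transversal_def)
  have hE: "h x \<in> E'" if "x \<in> E" for x using that h by auto
  \<comment> \<open>Some \<open>h y\<close> is related to \<open>h x\<close>; symmetry and
    transitivity then close the loop.\<close>
  have refl: "R' (h x) (h x)" if "x \<in> E" for x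
  proof -
    have "h x \<in> E'" using h that by auto
    moreover from this obtain y where y: "y \<in> E" "R' (h y) (h x)" using surj[of "h x"] by auto
    moreover have "h y \<in> E'" using h y by auto
    ultimately show ?thesis using sym[of "h y" "h x"] trans[of "h x" "h y" "h x"] by auto
  qed
  show "inj_on h A"
  proof (rule inj_onI)
    fix a b assume ab: "a \<in> A" "b \<in> A" "h a = h b"
    then have "R a b" "R b b" using AE R refl by (auto simp: subset_iff)
    then show "a = b" using ex1[of b] ab AE by blast
  qed
  have "\<exists>!a. a \<in> h ` A \<and> R' a z" if z: "z \<in> E'" for z
  proof -
    obtain x where x: "x \<in> E" "R' (h x) z" using surj z by blast
    obtain a where a: "a \<in> A" "R a x" using ex1[OF x(1)] by blast
    have az: "R' (h a) z"
      using trans[of "h a" "h x" z] R[of a x] a x z AE hE by auto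
    show ?thesis
    proof (rule ex1I)
      show "h a \<in> h ` A \<and> R' (h a) z" using a az by auto
    next
      fix c assume "c \<in> h ` A \<and> R' c z"
      then obtain b where b: "b \<in> A" "c = h b" "R' (h b) z" by auto
      have "R' (h b) (h x)" 
        using trans[of "h b" z "h x"] sym[of "h x" z] b x z AE hE by auto
      then have "R b x" using R b x AE by auto
      then show "c = h a" using ex1[OF x(1)] a b by blast
    qed
  qed
  then show "transversal R' E' (h ` A)" using AE fin hE by (auto simp: transversal_def)
qed

text \<open>\<open>\<kappa>\<close> is an invariant with finitely many values, fine enough to
  determine the class, so there are finitely many classes and one element is chosen from
  each.\<close>

lemma transversal_exists:
  fixes E :: "'a set"
  assumes fin: "finite (\<kappa> ` E)" and \<kappa>: "\<And>x y. x \<in> E \<Longrightarrow> y \<in> E \<Longrightarrow> \<kappa> x = \<kappa> y \<Longrightarrow> R x y"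
    and sym: "\<And>x y. x \<in> E \<Longrightarrow> y \<in> E \<Longrightarrow> R x y \<Longrightarrow> R y x"
    and trans: "\<And>x y z. x \<in> E \<Longrightarrow> y \<in> E \<Longrightarrow> z \<in> E \<Longrightarrow> R x y \<Longrightarrow> R y z \<Longrightarrow> R x z"
  obtains A where "transversal R E A"
proof -
  define c where "c x = {y \<in> E. R x y}" for x
  define s where "s C = (SOME y. y \<in> C)" for C :: "'a set"
  have cc: "c x = c y" if "x \<in> E" "y \<in> E" "R x y" for x y
    unfolding c_def using that sym trans by blast
  have self: "x \<in> c x" if "x \<in> E" for x
    using \<kappa>[of x x] that by (simp add: c_def)
  have s: "s (c x) \<in> c x" if "x \<in> E" for x
    unfolding s_def using self[OF that] by (rule someI)
  have "finite (c ` E)"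
  proof -
    have "c x = c (inv_into E \<kappa> (\<kappa> x))" if "x \<in> E" for x
      using that by (intro cc \<kappa>) (auto simp: inv_into_into f_inv_into_f)
    then have "c ` E \<subseteq> (\<lambda>t. c (inv_into E \<kappa> t)) ` \<kappa> ` E" by auto
    then show ?thesis using fin finite_surj by auto
  qed
  moreover have "s ` c ` E \<subseteq> E" using s by (auto simp: c_def)
  moreover have "\<exists>!a. a \<in> s ` c ` E \<and> R a x" if x: "x \<in> E" for x
  proof (rule ex1I)
    show "s (c x) \<in> s ` c ` E \<and> R (s (c x)) x" using x s[OF x] sym by (auto simp: c_def)
  next
    fix a assume a: "a \<in> s ` c ` E \<and> R a x"
    then obtain y where y: "y \<in> E" "a = s (c y)" by auto
    have "R y a" "a \<in> E" using s[OF y(1)] y(2) by (auto simp: c_def)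
    then show "a = s (c x)" using cc[of y x] trans[of y a x] a x y by auto
  qed
  ultimately show thesis using that[of "s ` c ` E"] by (simp add: transversal_def)
qed

subsection \<open>Amalgamations as double cosets\<close>

text \<open>\<open>age\<close> and \<open>amalgamations\<close> only contain graphs on natural
  numbers. \<open>code\<close> and \<open>decode\<close> move between a finite vertex set and its
  \<open>copy\<close> there; which injection is chosen is immaterial up to isomorphism.\<close>

definition code :: "'v set \<Rightarrow> 'v \<Rightarrow> nat" where
  "code T = (SOME \<beta>. inj_on \<beta> T)"

definition decode :: "'v set \<Rightarrow> nat \<Rightarrow> 'v" where
  "decode T = inv_into T (code T)"

definition copy :: "('v, 'i) mgraph \<Rightarrow> 'v set \<Rightarrow> (nat, 'i) mgraph" where
  "copy Y T = \<lparr>verts = code T ` T, idx = idx Y,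
     edges = (\<lambda>i. map_prod (code T) (code T) ` (edges Y i \<inter> T \<times> T))\<rparr>"

lemma inj_on_code: assumes "finite T" shows "inj_on (code T) T"
proof -
  have "\<exists>f :: 'a \<Rightarrow> nat. inj_on f T"
    using finite_imp_inj_to_nat_seg[OF assms] by blast
  then show ?thesis unfolding code_def by (rule someI_ex)
qed

lemma decode_code: "finite T \<Longrightarrow> v \<in> T \<Longrightarrow> decode T (code T v) = v"
  by (simp add: decode_def inj_on_code)

lemma isomorphism_code:
  assumes T: "finite T" shows "isomorphism (induced Y T) (copy Y T) (code T)"
proof -
  note inj = inj_on_code[OF T]
  have "(code T u, code T v) \<in> map_prod (code T) (code T) ` (edges Y i \<inter> T \<times> T) \<longleftrightarrow> (u, v) \<in> edges Y i"
    if "u \<in> T" "v \<in> T" for u v i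
    using that inj by (auto simp: inj_on_def intro: rev_image_eqI)
  then show ?thesis using inj by (auto simp: isomorphism_def embedding_def copy_def)
qed

lemma isomorphism_decode:
  "finite T \<Longrightarrow> isomorphism (copy Y T) (induced Y T) (decode T)"
  using isomorphism_inv[OF isomorphism_code[of T Y]] by (simp add: decode_def)

lemma embedding_decode:
  "finite T \<Longrightarrow> T \<subseteq> verts Y \<Longrightarrow> embedding (copy Y T) Y (decode T)"
  using isomorphism_decode[of T Y] by (simp add: isomorphism_induced_iff)

lemma decode_image: "finite T \<Longrightarrow> decode T ` verts (copy Y T) = T"
  using isomorphism_image[OF isomorphism_decode[of T Y]] by simp

lemma verts_copy: "verts (copy Y T) = code T ` T"
  by (simp add: copy_def)

lemma copy_in_age: "finite T \<Longrightarrow> T \<subseteq> verts Y \<Longrightarrow> copy Y T \<in> age Y"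
  unfolding age_def using embedding_decode[of T Y]
  by (auto simp: wf_mgraph_def copy_def)

lemma ageD: assumes "x \<in> age Y" shows "finite (verts x)" "\<exists>e. embedding x Y e" "idx x = idx Y"
  using assms by (auto simp: age_def embedding_def)

lemma amalgamationsD:
  assumes "(a, j1, j2) \<in> amalgamations Y x0 x1 x2 \<iota>1 \<iota>2"
  shows "a \<in> age Y" "embedding x1 a j1" "embedding x2 a j2"
    "\<And>v. v \<in> verts x0 \<Longrightarrow> j1 (\<iota>1 v) = j2 (\<iota>2 v)" "j1 ` verts x1 \<union> j2 ` verts x2 = verts a"
  using assms by (auto simp: amalgamations_def)

text \<open>An isomorphism of amalgamations becomes a map between finite subgraphs of
  \<open>Y\<close> and extends by homogeneity; conversely, an automorphism compatible with both legs
  carries one realization onto the other.\<close>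

lemma amalg_isomorphic_iff:
  assumes hom: "homogeneous Y"
    and a: "(a, j1, j2) \<in> amalgamations Y x0 x1 x2 \<iota>1 \<iota>2"
    and a': "(a', j1', j2') \<in> amalgamations Y x0 x1 x2 \<iota>1 \<iota>2"
    and e: "embedding a Y e" and e': "embedding a' Y e'"
  shows "amalg_isomorphic x1 x2 (a, j1, j2) (a', j1', j2') \<longleftrightarrow>
    (\<exists>k. isomorphism Y Y k \<and> (\<forall>v\<in>verts x1. k (e (j1 v)) = e' (j1' v)) \<and>
         (\<forall>v\<in>verts x2. k (e (j2 v)) = e' (j2' v)))" (is "?L \<longleftrightarrow> ?R")
proof
  note A = amalgamationsD[OF a] and A' = amalgamationsD[OF a']
  assume ?L
  then obtain \<phi> where \<phi>: "isomorphism a a' \<phi>" "\<forall>v\<in>verts x1. \<phi> (j1 v) = j1' v"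
    "\<forall>v\<in>verts x2. \<phi> (j2 v) = j2' v"
    by (auto simp: amalg_isomorphic_def)
  have "embedding a Y (\<lambda>v. e' (\<phi> v))"
    using \<phi>(1) e' embedding_comp isomorphism_embedding by blast
  then obtain k where "isomorphism Y Y k" "\<And>v. v \<in> verts a \<Longrightarrow> k (e v) = e' (\<phi> v)"
    using homogeneous_extend[OF hom _ e] ageD(1)[OF A(1)] by metis
  moreover have "j1 v \<in> verts a" if "v \<in> verts x1" for v using that A(2) by (simp add: embedding_in)
  moreover have "j2 v \<in> verts a" if "v \<in> verts x2" for v using that A(3) by (simp add: embedding_in)
  ultimately show ?R using \<phi>(2,3) by (intro exI[of _ k]) auto
next
  note A = amalgamationsD[OF a] and A' = amalgamationsD[OF a']
  assume ?R
  then obtain k where k: "isomorphism Y Y k" "\<forall>v\<in>verts x1. k (e (j1 v)) = e' (j1' v)"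
    "\<forall>v\<in>verts x2. k (e (j2 v)) = e' (j2' v)" by blast
  have emb: "embedding a Y (\<lambda>v. k (e v))"
    using k(1) e embedding_comp isomorphism_embedding by blast
  \<comment> \<open>Joint surjectivity: both vertex sets are covered by the images of
    \<open>x1\<close> and \<open>x2\<close>, where \<open>k\<close> is prescribed.\<close>
  have im: "(\<lambda>v. k (e v)) ` verts a = e' ` verts a'"
    unfolding A(5)[symmetric] A'(5)[symmetric] 
    using k(2,3) by (simp add: image_Un image_image cong: image_cong)
  have i1: "isomorphism a (induced Y (e' ` verts a')) (\<lambda>v. k (e v))"
    using emb im e' by (auto simp: isomorphism_induced_iff embedding_image)
  have i2: "isomorphism (induced Y (e' ` verts a')) a' (inv_into (verts a') e')"
    using e' by (intro isomorphism_inv) (auto simp: isomorphism_induced_iff embedding_image)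
  have "inv_into (verts a') e' (k (e (j1 v))) = j1' v" if "v \<in> verts x1" for v
    using that k e' A'(2) by (simp add: embedding_inj embedding_in)
  moreover have "inv_into (verts a') e' (k (e (j2 v))) = j2' v" if "v \<in> verts x2" for v
    using that k e' A'(3) by (simp add: embedding_inj embedding_in)
  ultimately show ?L
    using isomorphism_comp[OF i1 i2] by (auto simp: amalg_isomorphic_def)
qed

lemma amalg_isomorphic_trans:
  "amalg_isomorphic x1 x2 a b \<Longrightarrow> amalg_isomorphic x1 x2 b c \<Longrightarrow> amalg_isomorphic x1 x2 a c"
  unfolding amalg_isomorphic_def by (force split: prod.splits intro: isomorphism_comp)

lemma amalg_isomorphic_sym:
  assumes "amalg_isomorphic x1 x2 a b" "a \<in> amalgamations Y x0 x1 x2 \<iota>1 \<iota>2"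
  shows "amalg_isomorphic x1 x2 b a"
proof -
  obtain a0 j1 j2 b0 j1' j2' where ab: "a = (a0, j1, j2)" "b = (b0, j1', j2')"
    by (metis prod_cases3)
  obtain \<phi> where \<phi>: "isomorphism a0 b0 \<phi>" "\<forall>v\<in>verts x1. \<phi> (j1 v) = j1' v"
    "\<forall>v\<in>verts x2. \<phi> (j2 v) = j2' v"
    using assms(1) by (auto simp: amalg_isomorphic_def ab)
  note A = amalgamationsD[OF assms(2)[unfolded ab]]
  have "inv_into (verts a0) \<phi> (\<phi> v) = v" if "v \<in> verts a0" for v
    using that embedding_inj[OF isomorphism_embedding[OF \<phi>(1)]] by simp
  moreover have "j1 v \<in> verts a0" if "v \<in> verts x1" for v using that A(2) by (simp add: embedding_in)
  moreover have "j2 v \<in> verts a0" if "v \<in> verts x2" for v using that A(3) by (simp add: embedding_in)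
  ultimately have "\<forall>v\<in>verts x1. inv_into (verts a0) \<phi> (j1' v) = j1 v"
    "\<forall>v\<in>verts x2. inv_into (verts a0) \<phi> (j2' v) = j2 v"
    using \<phi>(2,3) by metis+
  then show ?thesis
    using isomorphism_inv[OF \<phi>(1)] unfolding ab amalg_isomorphic_def by auto
qed

text \<open>
  Realize \<open>x1\<close> and \<open>x2\<close> inside \<open>Y\<close> over the common image \<open>S0\<close> of \<open>x0\<close>. Every amalgamation is then
  realized by moving \<open>P\<close>, the image of \<open>x1\<close>, with an automorphism fixing \<open>S0\<close> pointwise, and two
  automorphisms give isomorphic amalgamations iff they agree on \<open>P\<close> up to an automorphism fixing
  \<open>S\<close>, the image of \<open>x2\<close>.
\<close>

locale amalgamation_problem =
  fixes Y :: "('v, 'i) mgraph" and x0 x1 x2 :: "(nat, 'i) mgraph"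
    and \<iota>1 \<iota>2 :: "nat \<Rightarrow> nat" and e1 e2 :: "nat \<Rightarrow> 'v" and S0 P S :: "'v set"
  assumes hom: "homogeneous Y"
    and age: "x1 \<in> age Y" "x2 \<in> age Y"
    and \<iota>: "embedding x0 x1 \<iota>1" "embedding x0 x2 \<iota>2"
    and e: "embedding x1 Y e1" "embedding x2 Y e2"
    and comp: "\<And>v. v \<in> verts x0 \<Longrightarrow> e1 (\<iota>1 v) = e2 (\<iota>2 v)"
    and S0_def: "S0 = (\<lambda>v. e2 (\<iota>2 v)) ` verts x0"
    and P_def: "P = e1 ` verts x1" and S_def: "S = e2 ` verts x2"
begin

lemma fin: "finite S" "finite P" and sub: "S \<subseteq> verts Y" "P \<subseteq> verts Y"
  using age e by (auto simp: S_def P_def ageD embedding_in)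

definition amalg :: "('v \<Rightarrow> 'v) \<Rightarrow> 'i amalg" where
  "amalg g = (copy Y (S \<union> g ` P), \<lambda>v. code (S \<union> g ` P) (g (e1 v)), \<lambda>v. code (S \<union> g ` P) (e2 v))"

lemma union_sub: assumes "g \<in> auts Y S0" shows "S \<union> g ` P \<subseteq> verts Y"
  using sub autsD(3)[OF assms] by auto

lemma fin_union: "finite (S \<union> g ` P)"
  using fin by simp

lemma decode_code_e:
  "v \<in> verts x1 \<Longrightarrow> decode (S \<union> f ` P) (code (S \<union> f ` P) (f (e1 v))) = f (e1 v)"
  "v \<in> verts x2 \<Longrightarrow> decode (S \<union> f ` P) (code (S \<union> f ` P) (e2 v)) = e2 v"
  by (intro decode_code fin_union; simp add: P_def S_def)+

lemma amalg_in:
  assumes g: "g \<in> auts Y S0" shows "amalg g \<in> amalgamations Y x0 x1 x2 \<iota>1 \<iota>2"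
proof -
  let ?T = "S \<union> g ` P"
  note T = union_sub[OF g] fin_union[of g]
  have c: "isomorphism (induced Y ?T) (copy Y ?T) (code ?T)"
    using isomorphism_code T by blast
  have "embedding x1 Y (\<lambda>v. g (e1 v))"
    using e(1) autsD(1)[OF g] embedding_comp isomorphism_embedding by blast
  then have "embedding x1 (induced Y ?T) (\<lambda>v. g (e1 v))"
    using T(1) by (auto simp: embedding_induced_iff P_def)
  then have 1: "embedding x1 (copy Y ?T) (\<lambda>v. code ?T (g (e1 v)))"
    using embedding_comp isomorphism_embedding[OF c] by blast
  have "embedding x2 (induced Y ?T) e2"
    using T(1) e(2) by (auto simp: embedding_induced_iff S_def)
  then have 2: "embedding x2 (copy Y ?T) (\<lambda>v. code ?T (e2 v))"
    using embedding_comp isomorphism_embedding[OF c] by blast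
  have "g (e1 (\<iota>1 v)) = e2 (\<iota>2 v)" if "v \<in> verts x0" for v
    using that comp autsD(2)[OF g] by (auto simp: S0_def)
  moreover have "(\<lambda>v. code ?T (g (e1 v))) ` verts x1 \<union> (\<lambda>v. code ?T (e2 v)) ` verts x2 = verts (copy Y ?T)"
    by (auto simp: verts_copy P_def S_def)
  ultimately show ?thesis
    using 1 2 copy_in_age[OF T(2,1)] by (simp add: amalg_def amalgamations_def)
qed

lemma coset_rel_iff:
  assumes g: "g \<in> auts Y S0" and h: "h \<in> auts Y S0"
  shows "coset_rel Y S P g h \<longleftrightarrow> amalg_isomorphic x1 x2 (amalg g) (amalg h)"
proof -
  note G = amalg_in[OF g, unfolded amalg_def] and H = amalg_in[OF h, unfolded amalg_def]
  have "amalg_isomorphic x1 x2 (amalg g) (amalg h) \<longleftrightarrow>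
    (\<exists>k. isomorphism Y Y k \<and> (\<forall>v\<in>verts x1. k (g (e1 v)) = h (e1 v)) \<and> (\<forall>v\<in>verts x2. k (e2 v) = e2 v))"
    unfolding amalg_def
    using amalg_isomorphic_iff[OF hom G H embedding_decode[OF fin_union union_sub[OF g]]
        embedding_decode[OF fin_union union_sub[OF h]]] by (simp add: decode_code_e)
  then show ?thesis by (auto simp: coset_rel_def auts_def S_def P_def)
qed

lemma amalg_onto:
  assumes A: "(a, j1, j2) \<in> amalgamations Y x0 x1 x2 \<iota>1 \<iota>2"
  shows "\<exists>g\<in>auts Y S0. amalg_isomorphic x1 x2 (amalg g) (a, j1, j2)"
proof -
  note A' = amalgamationsD[OF A]
  obtain e where e': "embedding a Y e" using ageD(2)[OF A'(1)] by blast
  have "embedding x2 Y (\<lambda>v. e (j2 v))" using e' A'(3) embedding_comp by blast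
  \<comment> \<open>\<open>k\<close> brings the copy of \<open>x2\<close> inside \<open>a\<close> to
    its fixed place \<open>S\<close>; \<open>g\<close> below carries the fixed copy of
    \<open>x1\<close> to where \<open>k\<close> has put the one inside \<open>a\<close>.\<close>
  then obtain k where k: "isomorphism Y Y k" "\<And>v. v \<in> verts x2 \<Longrightarrow> k (e (j2 v)) = e2 v"
    using homogeneous_extend[OF hom ageD(1)[OF age(2)] _ e(2)] by metis
  have ke: "embedding a Y (\<lambda>v. k (e v))" using e' k(1) embedding_comp isomorphism_embedding by blast
  have "embedding x1 Y (\<lambda>v. k (e (j1 v)))" using ke A'(2) embedding_comp by blast
  then obtain g where g: "isomorphism Y Y g" "\<And>v. v \<in> verts x1 \<Longrightarrow> g (e1 v) = k (e (j1 v))"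
    using homogeneous_extend[OF hom ageD(1)[OF age(1)] e(1)] by metis
  \<comment> \<open>The two legs of \<open>a\<close> agree on \<open>x0\<close>, so both
    prescriptions coincide there and \<open>g\<close> fixes \<open>S0\<close>.\<close>
  have "g (e2 (\<iota>2 v)) = e2 (\<iota>2 v)" if v: "v \<in> verts x0" for v
    using g(2)[of "\<iota>1 v"] k(2)[of "\<iota>2 v"] comp[OF v] A'(4)[OF v] \<iota> v by (simp add: embedding_in)
  then have gS: "g \<in> auts Y S0" using g(1) by (auto simp: auts_def S0_def)
  have "amalg_isomorphic x1 x2 (amalg g) (a, j1, j2)"
    unfolding amalg_def amalg_isomorphic_iff[OF hom amalg_in[OF gS, unfolded amalg_def] A
        embedding_decode[OF fin_union union_sub[OF gS]] ke]
    by (intro exI[of _ "\<lambda>v. v"]) (simp add: isomorphism_id decode_code_e g(2)[symmetric] k(2))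
  then show ?thesis using gS by blast
qed

lemma amalg_representatives_iff:
  "amalg_representatives Y x0 x1 x2 \<iota>1 \<iota>2 A \<longleftrightarrow>
     transversal (amalg_isomorphic x1 x2) (amalgamations Y x0 x1 x2 \<iota>1 \<iota>2) A"
  by (simp add: amalg_representatives_def transversal_def)

lemma transversal_amalg:
  assumes "transversal (coset_rel Y S P) (auts Y S0) A"
  shows "amalg_representatives Y x0 x1 x2 \<iota>1 \<iota>2 (amalg ` A)" "inj_on amalg A"
proof -
  have "\<exists>g\<in>auts Y S0. amalg_isomorphic x1 x2 (amalg g) z"
    if "z \<in> amalgamations Y x0 x1 x2 \<iota>1 \<iota>2" for z
    using amalg_onto that by (cases z) auto
  note * = transversal_image[OF assms _ coset_rel_iff this amalg_isomorphic_sym amalg_isomorphic_trans]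
  have sub: "amalg ` auts Y S0 \<subseteq> amalgamations Y x0 x1 x2 \<iota>1 \<iota>2"
    using amalg_in by auto
  show "amalg_representatives Y x0 x1 x2 \<iota>1 \<iota>2 (amalg ` A)"
    unfolding amalg_representatives_iff by (rule *(1)[OF sub])
  show "inj_on amalg A" by (rule *(2)[OF sub])
qed

text \<open>\<open>A\<close> yields one set of representatives, and isomorphism invariance of
  \<open>\<nu>\<close> carries its sum over to \<open>R\<close>.\<close>

lemma sum_representatives:
  assumes A: "transversal (coset_rel Y S P) (auts Y S0) A"
    and R: "amalg_representatives Y x0 x1 x2 \<iota>1 \<iota>2 R"
    and \<nu>: "\<And>a b. a \<in> age Y \<Longrightarrow> b \<in> age Y \<Longrightarrow> isomorphic a b \<Longrightarrow> \<nu> a = \<nu> b"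
  shows "(\<Sum>(a, j1, j2)\<in>R. \<nu> a) = (\<Sum>g\<in>A. \<nu> (copy Y (S \<union> g ` P)))"
proof -
  let ?E = "amalgamations Y x0 x1 x2 \<iota>1 \<iota>2"
  have "(\<Sum>(a, j1, j2)\<in>R. \<nu> a) = (\<Sum>(a, j1, j2)\<in>amalg ` A. \<nu> a)"
  proof (rule transversal_sum_eq)
    show "transversal (amalg_isomorphic x1 x2) ?E R"
      "transversal (amalg_isomorphic x1 x2) ?E (amalg ` A)"
      using R transversal_amalg[OF A] by (simp_all add: amalg_representatives_iff)
    show "(case y of (a, j1, j2) \<Rightarrow> \<nu> a) = (case z of (a, j1, j2) \<Rightarrow> \<nu> a)"
      if "y \<in> ?E" "z \<in> ?E" "amalg_isomorphic x1 x2 y z" for y z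
      using that by (auto simp: amalg_isomorphic_def isomorphic_def amalgamations_def intro!: \<nu>)
  qed (rule amalg_isomorphic_sym)
  also have "\<dots> = (\<Sum>g\<in>A. \<nu> (copy Y (S \<union> g ` P)))"
    unfolding sum.reindex[OF transversal_amalg(2)[OF A]] by (simp add: amalg_def)
  finally show ?thesis .
qed

end

subsection \<open>R-measures as functions on finite vertex sets\<close>

text \<open>
  The last conjunct is the amalgamation axiom for one-point extensions: \<open>p\<close> is added to \<open>S0\<close>, and
  its possible positions relative to \<open>S\<close> are counted up to automorphisms fixing \<open>S\<close>.
\<close>

definition set_measure :: "('v, 'i) mgraph \<Rightarrow> ('v set \<Rightarrow> 'k::field) \<Rightarrow> bool" where
  "set_measure Y m \<longleftrightarrow>
     m {} = 1 \<and> (\<forall>T. finite T \<longrightarrow> T \<subseteq> verts Y \<longrightarrow> m T \<noteq> 0) \<and>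
     (\<forall>T g. finite T \<longrightarrow> T \<subseteq> verts Y \<longrightarrow> isomorphism Y Y g \<longrightarrow> m (g ` T) = m T) \<and>
     (\<forall>S S0 p. finite S \<longrightarrow> S \<subseteq> verts Y \<longrightarrow> S0 \<subseteq> S \<longrightarrow> p \<in> verts Y \<longrightarrow>
        (\<exists>B. transversal (point_rel Y S) {q. point_rel Y S0 p q} B \<and>
             (\<Sum>b\<in>B. m (insert b S)) * m S0 = m (insert p S0) * m S))"

lemma set_measureD:
  assumes "set_measure Y m"
  shows "m {} = 1" "\<And>T. finite T \<Longrightarrow> T \<subseteq> verts Y \<Longrightarrow> m T \<noteq> 0"
    "\<And>T g. finite T \<Longrightarrow> T \<subseteq> verts Y \<Longrightarrow> isomorphism Y Y g \<Longrightarrow> m (g ` T) = m T"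
    "\<And>S S0 p. finite S \<Longrightarrow> S \<subseteq> verts Y \<Longrightarrow> S0 \<subseteq> S \<Longrightarrow> p \<in> verts Y \<Longrightarrow>
        \<exists>B. transversal (point_rel Y S) {q. point_rel Y S0 p q} B \<and>
             (\<Sum>b\<in>B. m (insert b S)) * m S0 = m (insert p S0) * m S"
  using assms unfolding set_measure_def by blast+

lemma finite_iso_classes_le:
  assumes "homogeneous_oligomorphic Y"
  shows "finite (iso_class Y ` {G \<in> fin_subgraphs Y. card (verts G) \<le> n})"
proof -
  have "{G \<in> fin_subgraphs Y. card (verts G) \<le> n} = (\<Union>i\<le>n. {G \<in> fin_subgraphs Y. card (verts G) = i})"
    by auto
  then show ?thesis using assms by (simp add: homogeneous_oligomorphic_def image_UN)
qed

text \<open>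
  Finiteness: record the isomorphism class of \<open>S \<union> g ` P\<close> and where a chosen isomorphism onto a
  chosen representative sends \<open>S\<close> and \<open>g ` P\<close>. Homogeneity shows that this datum determines the
  double coset.
\<close>

lemma coset_transversal_exists:
  assumes Y: "homogeneous_oligomorphic Y" and S: "finite S" "S \<subseteq> verts Y" and P: "finite P" "P \<subseteq> verts Y"
  obtains A where "transversal (coset_rel Y S P) (auts Y S0) A"
proof -
  let ?E = "auts Y S0"
  define T where "T g = S \<union> g ` P" for g
  have T: "finite (T g)" "T g \<subseteq> verts Y" if "g \<in> ?E" for g
    using S P autsD(3)[OF that] by (auto simp: T_def)
  have Tf: "induced Y (T g) \<in> fin_subgraphs Y" if "g \<in> ?E" for g
    using T[OF that] by (rule fin_subgraphsI)
  define c where "c g = iso_class Y (induced Y (T g))" for g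
  define r where "r C = (SOME H. H \<in> C)" for C :: "('a, 'b) mgraph set"
  have self: "induced Y (T g) \<in> c g" if "g \<in> ?E" for g
    using Tf[OF that] by (simp add: c_def iso_class_def isomorphic_refl)
  have r: "r (c g) \<in> c g" if "g \<in> ?E" for g
    unfolding r_def using self[OF that] by (rule someI)
  have "\<forall>g\<in>?E. \<exists>f. isomorphism (induced Y (T g)) (r (c g)) f"
    using r isomorphic_sym unfolding c_def iso_class_def isomorphic_def by fast
  then obtain f where f: "\<And>g. g \<in> ?E \<Longrightarrow> isomorphism (induced Y (T g)) (r (c g)) (f g)"
    by metis
  define \<kappa> where "\<kappa> g = (c g, restrict (f g) S, restrict (\<lambda>p. f g (g p)) P)" for g
  \<comment> \<open>At most \<open>card S + card P\<close> vertices occur, so only finitely many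
    isomorphism classes are met.\<close>
  define K where "K = iso_class Y ` {G \<in> fin_subgraphs Y. card (verts G) \<le> card S + card P}"
  have cK: "c g \<in> K" if g: "g \<in> ?E" for g
  proof -
    have "card (T g) \<le> card S + card (g ` P)" unfolding T_def by (rule card_Un_le)
    also have "\<dots> \<le> card S + card P" using card_image_le[OF P(1)] by simp
    finally show ?thesis unfolding K_def c_def using Tf[OF g] by auto
  qed
  have "\<kappa> ` ?E \<subseteq> Sigma (c ` ?E) (\<lambda>C. (S \<rightarrow>\<^sub>E verts (r C)) \<times> (P \<rightarrow>\<^sub>E verts (r C)))"
  proof (rule image_subsetI)
    fix g assume g: "g \<in> ?E"
    have "f g v \<in> verts (r (c g))" if "v \<in> T g" for v
      using that embedding_in[OF isomorphism_embedding[OF f[OF g]]] by simp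
    then show "\<kappa> g \<in> Sigma (c ` ?E) (\<lambda>C. (S \<rightarrow>\<^sub>E verts (r C)) \<times> (P \<rightarrow>\<^sub>E verts (r C)))"
      using g by (auto simp: \<kappa>_def T_def)
  qed
  moreover have "finite (Sigma (c ` ?E) (\<lambda>C. (S \<rightarrow>\<^sub>E verts (r C)) \<times> (P \<rightarrow>\<^sub>E verts (r C))))"
  proof (rule finite_SigmaI)
    have "finite K" unfolding K_def using Y by (rule finite_iso_classes_le)
    then show "finite (c ` ?E)" using cK by (meson finite_subset image_subsetI)
    show "finite ((S \<rightarrow>\<^sub>E verts (r C)) \<times> (P \<rightarrow>\<^sub>E verts (r C)))" if "C \<in> c ` ?E" for C
    proof -
      have "r C \<in> fin_subgraphs Y" using that r by (auto simp: c_def iso_class_def)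
      then show ?thesis using S P by (auto intro!: finite_PiE simp: fin_subgraphsD(1))
    qed
  qed
  ultimately have fin: "finite (\<kappa> ` ?E)" by (rule finite_subset)
  have rel: "coset_rel Y S P g h" if g: "g \<in> ?E" and h: "h \<in> ?E" and gh: "\<kappa> g = \<kappa> h" for g h
  proof -
    \<comment> \<open>Both unions are compared through their common representative. Equal labels on
      \<open>S\<close> make the comparison fix \<open>S\<close>; equal labels on \<open>P\<close>
      make it carry \<open>g p\<close> to \<open>h p\<close>.\<close>
    let ?\<phi> = "\<lambda>v. inv_into (T h) (f h) (f g v)"
    have cc: "c g = c h" "\<And>s. s \<in> S \<Longrightarrow> f g s = f h s" "\<And>p. p \<in> P \<Longrightarrow> f g (g p) = f h (h p)"
      using gh unfolding \<kappa>_def by (auto simp: restrict_def fun_eq_iff) metis+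
    have "isomorphism (induced Y (T g)) (induced Y (T h)) ?\<phi>"
      using isomorphism_comp[OF f[OF g, unfolded cc(1)] isomorphism_inv[OF f[OF h]]] by simp
    then have "embedding (induced Y (T g)) Y ?\<phi>"
      using isomorphism_induced_iff[OF T(2)[OF h]] by blast
    then obtain k where k: "isomorphism Y Y k" "\<And>v. v \<in> T g \<Longrightarrow> k v = ?\<phi> v"
      using homogeneous_extend[of Y "induced Y (T g)" "\<lambda>v. v" ?\<phi>] Y T[OF g] embedding_incl[of "T g" Y]
      by (auto simp: homogeneous_oligomorphic_def)
    have inj: "inj_on (f h) (T h)" using f[OF h] by (auto simp: isomorphism_def embedding_def)
    have "k s = s" if "s \<in> S" for s
      using that k(2)[of s] cc(2)[OF that] inj by (simp add: T_def)
    moreover have "k (g p) = h p" if "p \<in> P" for p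
      using that k(2)[of "g p"] cc(3)[OF that] inj by (simp add: T_def)
    ultimately show ?thesis using k(1) by (auto simp: coset_rel_def auts_def)
  qed
  show thesis
  proof (rule transversal_exists[OF fin rel])
    show "coset_rel Y S P h g" if "g \<in> ?E" "coset_rel Y S P g h" for g h
      using coset_rel_sym[OF that(2) S(2)] autsD(3)[OF that(1)] P by auto
  qed (auto intro: coset_rel_trans that)
qed

text \<open>Members of \<open>auts Y S0\<close> and \<open>auts Y S\<close> all fix
  \<open>S0\<close>, so on \<open>insert p S0\<close> only the image of \<open>p\<close>
  distinguishes cosets.\<close>

lemma transversal_points:
  assumes A: "transversal (coset_rel Y S (insert p S0)) (auts Y S0) A"
    and S: "S0 \<subseteq> S" "S \<subseteq> verts Y" and p: "p \<in> verts Y"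
  shows "transversal (point_rel Y S) {q. point_rel Y S0 p q} ((\<lambda>g. g p) ` A)" "inj_on (\<lambda>g. g p) A"
proof -
  have *: "coset_rel Y S (insert p S0) g h \<longleftrightarrow> point_rel Y S (g p) (h p)"
    if "g \<in> auts Y S0" "h \<in> auts Y S0" for g h
    using that S(1) autsD(2) unfolding coset_rel_def point_rel_def
    by (metis (no_types, lifting) insert_iff subsetD)
  have **: "\<exists>g\<in>auts Y S0. point_rel Y S (g p) q" if q: "q \<in> {q. point_rel Y S0 p q}" for q
  proof -
    obtain g where "g \<in> auts Y S0" "g p = q" using q by (auto simp: point_rel_def)
    then show ?thesis using point_rel_refl[of Y S q] by blast
  qed
  have sub: "(\<lambda>g. g p) ` auts Y S0 \<subseteq> {q. point_rel Y S0 p q}" by (auto simp: point_rel_def)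
  have in_verts: "q \<in> verts Y" if "q \<in> {q. point_rel Y S0 p q}" for q
    using that p point_rel_in by fast
  have sym: "point_rel Y S r q" if "q \<in> {q. point_rel Y S0 p q}" "point_rel Y S q r" for q r
    using point_rel_sym[OF that(2) S(2) in_verts[OF that(1)]] .
  note image = transversal_image[OF A sub * ** sym point_rel_trans]
  show "transversal (point_rel Y S) {q. point_rel Y S0 p q} ((\<lambda>g. g p) ` A)" by (rule image(1))
  show "inj_on (\<lambda>g. g p) A" by (rule image(2))
qed

section \<open>Reading an R-measure as a function on finite vertex sets\<close>

lemma R_measureD:
  assumes "R_measure X \<nu>"
  shows "homogeneous_oligomorphic X" "\<And>x. x \<in> age X \<Longrightarrow> \<nu> x \<noteq> 0"
    "\<And>x y. x \<in> age X \<Longrightarrow> y \<in> age X \<Longrightarrow> isomorphic x y \<Longrightarrow> \<nu> x = \<nu> y"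
    "\<And>x. x \<in> age X \<Longrightarrow> verts x = {} \<Longrightarrow> \<nu> x = 1"
    "\<And>x0 x1 x2 \<iota>1 \<iota>2 A. x0 \<in> age X \<Longrightarrow> x1 \<in> age X \<Longrightarrow> x2 \<in> age X \<Longrightarrow>
       embedding x0 x1 \<iota>1 \<Longrightarrow> embedding x0 x2 \<iota>2 \<Longrightarrow> amalg_representatives X x0 x1 x2 \<iota>1 \<iota>2 A \<Longrightarrow>
       \<nu> x1 * \<nu> x2 = \<nu> x0 * (\<Sum>(a, j1, j2)\<in>A. \<nu> a)"
  using assms unfolding R_measure_def by blast+

text \<open>The one-point law is the amalgamation axiom for the inclusions of \<open>S0\<close> in
  \<open>insert p S0\<close> and in \<open>S\<close>, all three replaced by their copies on natural
  numbers.\<close>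

lemma set_measure_of_R_measure:
  assumes \<nu>: "R_measure X \<nu>"
  shows "set_measure X (\<lambda>T. \<nu> (copy X T))"
proof -
  note R = R_measureD[OF \<nu>]
  have hom: "homogeneous X" using R(1) by (simp add: homogeneous_oligomorphic_def)
  have inv: "\<nu> (copy X (g ` T)) = \<nu> (copy X T)"
    if T: "finite T" "T \<subseteq> verts X" and g: "isomorphism X X g" for T g
  proof -
    have gT: "finite (g ` T)" "g ` T \<subseteq> verts X"
      using T embedding_in[OF isomorphism_embedding[OF g]] by auto
    have "isomorphism (induced X T) (induced X (g ` T)) g"
      using gT T isomorphism_embedding[OF g] by (auto simp: isomorphism_induced_iff embedding_induced_dom)
    then have "isomorphism (copy X T) (copy X (g ` T)) (\<lambda>v. code (g ` T) (g (decode T v)))"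
      using isomorphism_comp[OF isomorphism_comp[OF isomorphism_decode[OF T(1)]] isomorphism_code[OF gT(1)]]
      by blast
    then have "isomorphic (copy X T) (copy X (g ` T))" by (auto simp: isomorphic_def)
    then show ?thesis using R(3) copy_in_age T gT by metis
  qed
  have law: "\<exists>B. transversal (point_rel X S) {q. point_rel X S0 p q} B \<and>
      (\<Sum>b\<in>B. \<nu> (copy X (insert b S))) * \<nu> (copy X S0) = \<nu> (copy X (insert p S0)) * \<nu> (copy X S)"
    if S: "finite S" "S \<subseteq> verts X" "S0 \<subseteq> S" and p: "p \<in> verts X" for S S0 p
  proof -
    let ?P = "insert p S0"
    have S0: "finite S0" "S0 \<subseteq> verts X" using S finite_subset by auto
    have P: "finite ?P" "?P \<subseteq> verts X" using S0 p by auto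
    \<comment> \<open>The inclusion of \<open>S0\<close> in \<open>T\<close>, read between the
      copies.\<close>
    define j where "j T v = code T (decode S0 v)" for T v
    have j: "embedding (copy X S0) (copy X T) (j T)" "\<And>v. v \<in> verts (copy X S0) \<Longrightarrow> decode T (j T v) = decode S0 v"
      if T: "S0 \<subseteq> T" "finite T" "T \<subseteq> verts X" for T
    proof -
      have "embedding (copy X S0) (induced X T) (decode S0)"
        using embedding_decode[OF S0] T decode_image[OF S0(1), of X] by (simp add: embedding_induced_iff)
      then show "embedding (copy X S0) (copy X T) (j T)"
        unfolding j_def using isomorphism_code[OF T(2)] embedding_comp isomorphism_embedding by blast
      show "decode T (j T v) = decode S0 v" if "v \<in> verts (copy X S0)" for v
        using that T decode_image[OF S0(1), of X] unfolding j_def by (intro decode_code) auto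
    qed
    interpret amalgamation_problem X "copy X S0" "copy X ?P" "copy X S" "j ?P" "j S" "decode ?P" "decode S" S0 ?P S
    proof
      have "(\<lambda>v. decode S (j S v)) ` verts (copy X S0) = decode S0 ` verts (copy X S0)"
        using j(2)[OF S(3,1,2)] by (rule image_cong[OF refl])
      then show "S0 = (\<lambda>v. decode S (j S v)) ` verts (copy X S0)"
        by (simp only: decode_image[OF S0(1)])
      show "decode ?P (j ?P v) = decode S (j S v)" if "v \<in> verts (copy X S0)" for v
        using that j(2)[OF _ P, of v] j(2)[OF S(3,1,2), of v] by auto
      show "?P = decode ?P ` verts (copy X ?P)" "S = decode S ` verts (copy X S)"
        using decode_image P S by metis+
    qed (use hom P S j(1)[OF _ P] j(1)[OF S(3,1,2)] in \<open>auto intro: copy_in_age embedding_decode\<close>)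
    obtain A where A: "transversal (coset_rel X S ?P) (auts X S0) A"
      using coset_transversal_exists[OF R(1) S(1,2) P] by blast
    have "\<nu> (copy X ?P) * \<nu> (copy X S) = \<nu> (copy X S0) * (\<Sum>(a, j1, j2)\<in>amalg ` A. \<nu> a)"
      using R(5) copy_in_age[OF S0] age \<iota> transversal_amalg(1)[OF A] by metis
    also have "(\<Sum>(a, j1, j2)\<in>amalg ` A. \<nu> a) = (\<Sum>g\<in>A. \<nu> (copy X (S \<union> g ` ?P)))"
      using sum_representatives[OF A transversal_amalg(1)[OF A]] R(3) by metis
    also have "\<dots> = (\<Sum>g\<in>A. \<nu> (copy X (insert (g p) S)))"
    proof (rule sum.cong[OF refl])
      fix g assume "g \<in> A"
      then have "g \<in> auts X S0" using A by (auto simp: transversal_def)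
      then have "S \<union> g ` ?P = insert (g p) S" using autsD(2) S(3) by force
      then show "\<nu> (copy X (S \<union> g ` ?P)) = \<nu> (copy X (insert (g p) S))" by simp
    qed
    also have "\<dots> = (\<Sum>b\<in>(\<lambda>g. g p) ` A. \<nu> (copy X (insert b S)))"
      using transversal_points(2)[OF A S(3,2) p] by (simp add: sum.reindex)
    finally show ?thesis
      using transversal_points(1)[OF A S(3,2) p] by (intro exI conjI) (auto simp: mult.commute)
  qed
  show ?thesis unfolding set_measure_def
  proof (intro conjI allI impI)
    show "\<nu> (copy X {}) = 1" using R(4)[OF copy_in_age[of "{}" X]] by (simp add: verts_copy)
  qed (use R(2) copy_in_age inv law in auto)
qed

lemma R_measure_copy:
  assumes "R_measure X \<nu>" and x: "x \<in> age X" and e: "embedding x X e"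
  shows "\<nu> (copy X (e ` verts x)) = \<nu> x"
proof -
  have "finite (e ` verts x)" "e ` verts x \<subseteq> verts X" using x e by (auto simp: ageD embedding_in)
  moreover from this have "isomorphic x (copy X (e ` verts x))"
    using isomorphic_trans isomorphic_induced_image[OF e] isomorphism_code by (metis isomorphic_def)
  ultimately show ?thesis using R_measureD(3)[OF assms(1) x copy_in_age] by metis
qed

text \<open>
  The one-point law yields the law for all extensions by adding the points of \<open>P - S0\<close> one at a
  time: an amalgamation with \<open>insert p Q\<close> is an amalgamation with \<open>Q\<close> followed by a position
  of the image of \<open>p\<close>.
\<close>

lemma coset_law:
  assumes m: "set_measure Y m" and S0: "S0 \<subseteq> S" and S: "finite S" "S \<subseteq> verts Y"
    and P: "finite P" "S0 \<subseteq> P" "P \<subseteq> verts Y"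
  shows "\<exists>A. transversal (coset_rel Y S P) (auts Y S0) A \<and> (\<Sum>g\<in>A. m (S \<union> g ` P)) * m S0 = m P * m S"
proof -
  note M = set_measureD[OF m]
  have "finite (P - S0)" "P - S0 \<subseteq> verts Y" "S0 \<union> (P - S0) = P" using P by auto
  moreover have "finite Q \<Longrightarrow> Q \<subseteq> verts Y \<Longrightarrow>
     \<exists>A. transversal (coset_rel Y S (S0 \<union> Q)) (auts Y S0) A \<and>
         (\<Sum>g\<in>A. m (S \<union> g ` (S0 \<union> Q))) * m S0 = m (S0 \<union> Q) * m S" for Q
  proof (induction Q rule: finite_induct)
    case empty
    \<comment> \<open>All automorphisms fixing \<open>S0\<close> agree on it, so there is one coset,
      represented by the identity.\<close>
    have "transversal (coset_rel Y S S0) (auts Y S0) {\<lambda>v. v}"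
      using auts_id by (fastforce simp: transversal_def coset_rel_def autsD)
    moreover have "S \<union> S0 = S" using S0 by auto
    ultimately show ?case by (intro exI[of _ "{\<lambda>v. v}"]) simp
  next
    case (insert p Q)
    let ?P = "S0 \<union> Q"
    have P': "?P \<subseteq> verts Y" "finite ?P" using insert S0 S finite_subset by auto
    have p: "p \<in> verts Y" using insert by auto
    obtain A where A: "transversal (coset_rel Y S ?P) (auts Y S0) A"
      and sumA: "(\<Sum>g\<in>A. m (S \<union> g ` ?P)) * m S0 = m ?P * m S" using insert by auto
    have Aut: "g \<in> auts Y S0" if "g \<in> A" for g using A that by (auto simp: transversal_def)
    have gP: "g ` ?P \<subseteq> verts Y" "finite (g ` ?P)" "g p \<in> verts Y" if "g \<in> A" for g
      using P' p autsD(3)[OF Aut[OF that]] by auto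
    \<comment> \<open>For each old coset \<open>g\<close>, the one-point law is applied with the
      image of \<open>?P\<close> as base: \<open>B g\<close> will list the places where
      \<open>p\<close> can go once \<open>?P\<close> has been placed by \<open>g\<close>.\<close>
    have "\<forall>g\<in>A. \<exists>B. transversal (point_rel Y (S \<union> g ` ?P)) {q. point_rel Y (g ` ?P) (g p) q} B \<and>
      (\<Sum>b\<in>B. m (insert b (S \<union> g ` ?P))) * m (g ` ?P) = m (insert (g p) (g ` ?P)) * m (S \<union> g ` ?P)"
    proof
      fix g assume "g \<in> A"
      note g = gP[OF this]
      then show "\<exists>B. transversal (point_rel Y (S \<union> g ` ?P)) {q. point_rel Y (g ` ?P) (g p) q} B \<and>
        (\<Sum>b\<in>B. m (insert b (S \<union> g ` ?P))) * m (g ` ?P) = m (insert (g p) (g ` ?P)) * m (S \<union> g ` ?P)"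
        using S by (intro M(4)) auto
    qed
    then obtain B where B: "\<And>g. g \<in> A \<Longrightarrow>
        transversal (point_rel Y (S \<union> g ` ?P)) {q. point_rel Y (g ` ?P) (g p) q} (B g)"
      and sumB: "\<And>g. g \<in> A \<Longrightarrow> (\<Sum>b\<in>B g. m (insert b (S \<union> g ` ?P))) * m (g ` ?P) =
        m (insert (g p) (g ` ?P)) * m (S \<union> g ` ?P)" by metis
    have "\<forall>g\<in>A. \<forall>b\<in>B g. \<exists>k\<in>auts Y (g ` ?P). k (g p) = b"
      using B by (auto simp: transversal_def point_rel_def)
    then obtain k where k: "\<And>g b. g \<in> A \<Longrightarrow> b \<in> B g \<Longrightarrow> k g b \<in> auts Y (g ` ?P)"
      and kp: "\<And>g b. g \<in> A \<Longrightarrow> b \<in> B g \<Longrightarrow> k g b (g p) = b" by metis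
    have kP: "k g b (g v) = g v" if "g \<in> A" "b \<in> B g" "v \<in> ?P" for g b v
      using k[OF that(1,2)] that(3) by (auto simp: auts_def)
    \<comment> \<open>\<open>k g b\<close> fixes the image of \<open>?P\<close> under
      \<open>g\<close> and moves \<open>g p\<close> to \<open>b\<close>, so the composite acts on
      \<open>?P\<close> like \<open>g\<close> and sends \<open>p\<close> to
      \<open>b\<close>.\<close>
    define h where "h = (\<lambda>(g, b) v. k g b (g v))"
    define C where "C = h ` Sigma A B"
    have img: "h (g, b) ` (S0 \<union> insert p Q) = insert b (g ` ?P)" if "g \<in> A" "b \<in> B g" for g b
    proof -
      have "S0 \<union> insert p Q = insert p ?P" by auto
      moreover have "h (g, b) ` ?P = g ` ?P" using kP[OF that] by (auto simp: h_def)
      ultimately show ?thesis using kp[OF that] by (simp add: h_def)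
    qed
    have hA: "h (g, b) \<in> auts Y S0" if "g \<in> A" "b \<in> B g" for g b
    proof -
      have "k g b s = s" if "s \<in> S0" for s
        using kP[OF \<open>g \<in> A\<close> \<open>b \<in> B g\<close>, of s] autsD(2)[OF Aut[OF \<open>g \<in> A\<close>] that] that by simp
      then have "k g b \<in> auts Y S0" using autsD(1)[OF k[OF that]] by (auto simp: auts_def)
      then show ?thesis using auts_comp[OF Aut[OF that(1)]] by (simp add: h_def)
    qed
    let ?R = "coset_rel Y S (S0 \<union> insert p Q)"
    \<comment> \<open>Restriction to \<open>?P\<close> recovers \<open>g\<close> by uniqueness in
      \<open>A\<close>; then \<open>u\<close> fixes the image of \<open>?P\<close>, and uniqueness
      in \<open>B g\<close> recovers \<open>b\<close>.\<close>
    have uniq: "g = g' \<and> b = b'"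
      if g: "g \<in> A" "b \<in> B g" and g': "g' \<in> A" "b' \<in> B g'" and rel: "?R (h (g, b)) (h (g', b'))" for g b g' b'
    proof -
      obtain u where u: "u \<in> auts Y S" "\<And>v. v \<in> S0 \<union> insert p Q \<Longrightarrow> u (h (g, b) v) = h (g', b') v"
        using rel by (auto simp: coset_rel_def)
      have ug: "u (g v) = g' v" if "v \<in> ?P" for v
        using u(2)[of v] kP[OF g that] kP[OF g' that] that by (auto simp: h_def)
      then have "coset_rel Y S ?P g g'" "coset_rel Y S ?P g' g'"
        using u(1) by (auto simp: coset_rel_def intro: bexI[OF _ auts_id])
      moreover have "\<exists>!a. a \<in> A \<and> coset_rel Y S ?P a g'"
        using A Aut[OF g'(1)] by (simp add: transversal_def)
      ultimately have eq: "g = g'" using g(1) g'(1) by blast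
      have "u \<in> auts Y (S \<union> g ` ?P)" using u(1) ug eq by (auto simp: auts_def)
      moreover have "u b = b'" using u(2)[of p] kp[OF g] kp[OF g'] by (simp add: h_def)
      ultimately have "point_rel Y (S \<union> g ` ?P) b b'" "point_rel Y (S \<union> g ` ?P) b' b'"
        using point_rel_refl by (auto simp: point_rel_def)
      then have "b = b'" using B[OF g(1)] g(2) g'(2) eq unfolding transversal_def by blast
      then show ?thesis using eq by simp
    qed
    have inj: "inj_on h (Sigma A B)"
    proof (rule inj_onI)
      fix c c' assume c: "c \<in> Sigma A B" "c' \<in> Sigma A B" "h c = h c'"
      have "?R (h (fst c, snd c)) (h (fst c', snd c'))" using coset_rel_refl c(3) by simp
      then show "c = c'" using uniq[of "fst c" "snd c" "fst c'" "snd c'"] c(1,2) by (auto simp: prod_eq_iff)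
    qed
    have tr: "transversal ?R (auts Y S0) C"
      unfolding transversal_def
    proof (intro conjI ballI)
      show "finite C" using A B by (auto simp: C_def transversal_def)
      show "C \<subseteq> auts Y S0" using hA by (auto simp: C_def)
      fix f assume f: "f \<in> auts Y S0"
      \<comment> \<open>\<open>g\<close> agrees with \<open>f\<close> on \<open>?P\<close> up to
        \<open>l\<close>. After undoing \<open>l\<close>, the point \<open>l' (f p)\<close> lies in
        the orbit of \<open>g p\<close> over the image of \<open>?P\<close>, and its representative
        in \<open>B g\<close> is the required \<open>b\<close>.\<close>
      obtain g l where g: "g \<in> A" and l: "l \<in> auts Y S" "\<And>v. v \<in> ?P \<Longrightarrow> l (g v) = f v"
        using A f by (force simp: transversal_def coset_rel_def)
      obtain l' where l': "l' \<in> auts Y S" "\<And>v. v \<in> verts Y \<Longrightarrow> l' (l v) = v" "\<And>v. v \<in> verts Y \<Longrightarrow> l (l' v) = v"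
        using auts_inv[OF l(1) S(2)] by metis
      obtain gi where gi: "gi \<in> auts Y S0" "\<And>v. v \<in> verts Y \<Longrightarrow> gi (g v) = v"
        using auts_inv[OF Aut[OF g]] S0 S by (metis subset_trans)
      have "l' (f (gi (g v))) = g v" if "v \<in> ?P" for v
      proof -
        have "v \<in> verts Y" "g v \<in> verts Y" using that P'(1) gP(1)[OF g] by auto
        then show ?thesis using gi(2)[of v] l(2)[OF that] l'(2)[of "g v"] by simp
      qed
      then have "(\<lambda>v. l' (f (gi v))) \<in> auts Y (g ` ?P)"
        using isomorphism_comp[OF isomorphism_comp[OF autsD(1)[OF gi(1)] autsD(1)[OF f]] autsD(1)[OF l'(1)]]
        by (auto simp: auts_def)
      moreover have "l' (f (gi (g p))) = l' (f p)" using gi(2)[OF p] by simp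
      ultimately have "point_rel Y (g ` ?P) (g p) (l' (f p))" by (auto simp: point_rel_def)
      then obtain b where b: "b \<in> B g" "point_rel Y (S \<union> g ` ?P) b (l' (f p))"
        using B[OF g] by (auto simp: transversal_def)
      then obtain t where t: "t \<in> auts Y (S \<union> g ` ?P)" "t b = l' (f p)" by (auto simp: point_rel_def)
      have "l (t (h (g, b) v)) = f v" if "v \<in> S0 \<union> insert p Q" for v
      proof (cases "v = p")
        case True
        then show ?thesis using kp[OF g b(1)] t(2) l'(3)[of "f p"] autsD(3)[OF f p] by (simp add: h_def)
      next
        case False
        then have v: "v \<in> ?P" using that by auto
        then show ?thesis using kP[OF g b(1) v] autsD(2)[OF t(1), of "g v"] l(2)[OF v] by (auto simp: h_def)
      qed
      moreover have "(\<lambda>v. l (t v)) \<in> auts Y S"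
        using auts_comp l(1) t(1) auts_mono[of S "S \<union> g ` ?P" Y] by blast
      ultimately have hb: "?R (h (g, b)) f"
        unfolding coset_rel_def by (intro bexI[of _ "\<lambda>v. l (t v)"]) auto
      show "\<exists>!c. c \<in> C \<and> ?R c f"
      proof (rule ex1I)
        show "h (g, b) \<in> C \<and> ?R (h (g, b)) f" using hb g b(1) by (auto simp: C_def)
      next
        fix c assume c: "c \<in> C \<and> ?R c f"
        then obtain g' b' where g': "c = h (g', b')" "g' \<in> A" "b' \<in> B g'" by (auto simp: C_def)
        have "?R f c"
          using c coset_rel_sym[of Y S _ c f] S hA[OF g'(2,3)] autsD(3)[of c Y S0] p P' g'(1) by blast
        then have "?R (h (g, b)) (h (g', b'))" using hb coset_rel_trans g'(1) by blast
        then show "c = h (g, b)" using uniq g b(1) g' by blast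
      qed
    qed
    have wt: "(\<Sum>b\<in>B g. m (S \<union> h (g, b) ` (S0 \<union> insert p Q))) * m ?P = m (S0 \<union> insert p Q) * m (S \<union> g ` ?P)"
      if g: "g \<in> A" for g
    proof -
      have "m (g ` ?P) = m ?P" using M(3) P' autsD(1)[OF Aut[OF g]] by blast
      moreover have "m (insert (g p) (g ` ?P)) = m (S0 \<union> insert p Q)"
        using M(3)[of "S0 \<union> insert p Q" g] P' p autsD(1)[OF Aut[OF g]] by (simp add: image_Un)
      moreover have "(\<Sum>b\<in>B g. m (S \<union> h (g, b) ` (S0 \<union> insert p Q))) = (\<Sum>b\<in>B g. m (insert b (S \<union> g ` ?P)))"
        using img[OF g] by (intro sum.cong) auto
      ultimately show ?thesis using sumB[OF g] by simp
    qed
    have fin: "finite A" "\<And>g. g \<in> A \<Longrightarrow> finite (B g)" using A B by (auto simp: transversal_def)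
    have "(\<Sum>f\<in>C. m (S \<union> f ` (S0 \<union> insert p Q))) * m ?P =
        (\<Sum>g\<in>A. (\<Sum>b\<in>B g. m (S \<union> h (g, b) ` (S0 \<union> insert p Q))) * m ?P)"
      unfolding C_def using fin by (simp add: sum.reindex[OF inj] sum.Sigma sum_distrib_right)
    also have "\<dots> = m (S0 \<union> insert p Q) * (\<Sum>g\<in>A. m (S \<union> g ` ?P))"
      using wt by (simp add: sum_distrib_left)
    finally have "(\<Sum>f\<in>C. m (S \<union> f ` (S0 \<union> insert p Q))) * m S0 * m ?P = m (S0 \<union> insert p Q) * m S * m ?P"
      using sumA by (simp add: algebra_simps)
    \<comment> \<open>Chaining the two laws leaves the intermediate factor \<open>m ?P\<close> on
      both sides; it is non-zero and cancels.\<close>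
    then have "(\<Sum>f\<in>C. m (S \<union> f ` (S0 \<union> insert p Q))) * m S0 = m (S0 \<union> insert p Q) * m S"
      using M(2)[OF P'(2,1)] by simp
    then show ?case using tr by blast
  qed
  ultimately show ?thesis by metis
qed

section \<open>From functions on finite vertex sets back to R-measures\<close>

definition pull_measure :: "('v, 'i) mgraph \<Rightarrow> ('v set \<Rightarrow> 'k) \<Rightarrow> (nat, 'i) mgraph \<Rightarrow> 'k" where
  "pull_measure Y m x = m ((SOME e. embedding x Y e) ` verts x)"

text \<open>The embedding chosen in \<open>pull_measure\<close> differs from \<open>e\<close> by an
  automorphism on the vertices of \<open>x\<close>, and \<open>m\<close> is invariant under
  automorphisms.\<close>

lemma pull_measure_eq:
  assumes m: "set_measure Y m" and hom: "homogeneous Y" and x: "x \<in> age Y" and e: "embedding x Y e"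
  shows "pull_measure Y m x = m (e ` verts x)"
proof -
  have e': "embedding x Y (SOME e. embedding x Y e)" (is "embedding x Y ?e") using e by (rule someI[of "embedding x Y"])
  then obtain g where g: "isomorphism Y Y g" "\<And>v. v \<in> verts x \<Longrightarrow> g (e v) = ?e v"
    using homogeneous_extend[OF hom ageD(1)[OF x] e] by metis
  have "?e ` verts x = g ` e ` verts x" using g(2) by (auto simp: image_image)
  then show ?thesis unfolding pull_measure_def
    using set_measureD(3)[OF m _ embedding_image[OF e] g(1)] ageD(1)[OF x] by simp
qed

lemma R_measure_of_set_measure:
  assumes m: "set_measure Y m" and Y: "homogeneous_oligomorphic Y"
  shows "R_measure Y (pull_measure Y m)"
proof -
  note M = set_measureD[OF m]
  have hom: "homogeneous Y" using Y by (simp add: homogeneous_oligomorphic_def)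
  note pm = pull_measure_eq[OF m hom]
  have iso: "pull_measure Y m x = pull_measure Y m y"
    if x: "x \<in> age Y" and y: "y \<in> age Y" and xy: "isomorphic x y" for x y
  proof -
    obtain \<phi> where \<phi>: "isomorphism x y \<phi>" using xy by (auto simp: isomorphic_def)
    obtain e where e: "embedding y Y e" using ageD(2)[OF y] by blast
    have "embedding x Y (\<lambda>v. e (\<phi> v))" using embedding_comp[OF isomorphism_embedding[OF \<phi>] e] .
    then have "pull_measure Y m x = m (e ` \<phi> ` verts x)" using pm[OF x] by (simp add: image_image)
    then show ?thesis using pm[OF y e] isomorphism_image[OF \<phi>] by simp
  qed
  have law: "pull_measure Y m x1 * pull_measure Y m x2 = pull_measure Y m x0 * (\<Sum>(a, j1, j2)\<in>R. pull_measure Y m a)"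
    if x: "x0 \<in> age Y" "x1 \<in> age Y" "x2 \<in> age Y" and \<iota>: "embedding x0 x1 \<iota>1" "embedding x0 x2 \<iota>2"
      and R: "amalg_representatives Y x0 x1 x2 \<iota>1 \<iota>2 R" for x0 x1 x2 \<iota>1 \<iota>2 R
  proof -
    obtain e2 where e2: "embedding x2 Y e2" using ageD(2)[OF x(3)] by blast
    obtain e where e: "embedding x1 Y e" using ageD(2)[OF x(2)] by blast
    have e20: "embedding x0 Y (\<lambda>v. e2 (\<iota>2 v))" and "embedding x0 Y (\<lambda>v. e (\<iota>1 v))"
      using e2 e \<iota> embedding_comp by blast+
    \<comment> \<open>The embeddings chosen for \<open>x1\<close> and \<open>x2\<close> need not
      agree on \<open>x0\<close>; an automorphism moves the first so that they do.\<close>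
    then obtain g where g: "isomorphism Y Y g" "\<And>v. v \<in> verts x0 \<Longrightarrow> g (e (\<iota>1 v)) = e2 (\<iota>2 v)"
      using homogeneous_extend[OF hom ageD(1)[OF x(1)]] by metis
    have e1: "embedding x1 Y (\<lambda>v. g (e v))" using e g(1) embedding_comp isomorphism_embedding by blast
    define S0 where "S0 = (\<lambda>v. e2 (\<iota>2 v)) ` verts x0"
    define P where "P = (\<lambda>v. g (e v)) ` verts x1"
    define S where "S = e2 ` verts x2"
    interpret amalgamation_problem Y x0 x1 x2 \<iota>1 \<iota>2 "\<lambda>v. g (e v)" e2 S0 P S
      by standard (use hom x \<iota> e1 e2 g(2) in \<open>auto simp: S0_def P_def S_def\<close>)
    have sub0: "S0 \<subseteq> S" "S0 \<subseteq> P"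
      using embedding_in[OF \<iota>(1)] embedding_in[OF \<iota>(2)] g(2)
      by (auto simp: S0_def S_def P_def image_iff) metis
    obtain A where A: "transversal (coset_rel Y S P) (auts Y S0) A"
      and sumA: "(\<Sum>g\<in>A. m (S \<union> g ` P)) * m S0 = m P * m S"
      using coset_law[OF m sub0(1) fin(1) sub(1) fin(2) sub0(2) sub(2)] by blast
    have "pull_measure Y m (copy Y (S \<union> f ` P)) = m (S \<union> f ` P)" if "f \<in> A" for f
    proof -
      have "f \<in> auts Y S0" using A that by (auto simp: transversal_def)
      note T = fin_union[of f] union_sub[OF this]
      show ?thesis
        unfolding pm[OF copy_in_age[OF T] embedding_decode[OF T]] decode_image[OF T(1)] ..
    qed
    then have "(\<Sum>(a, j1, j2)\<in>R. pull_measure Y m a) = (\<Sum>g\<in>A. m (S \<union> g ` P))"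
      using sum_representatives[OF A R iso] by simp
    moreover have "pull_measure Y m x0 = m S0" "pull_measure Y m x1 = m P" "pull_measure Y m x2 = m S"
      using pm[OF x(1) e20] pm[OF x(2) e1] pm[OF x(3) e2] by (auto simp: S0_def P_def S_def)
    ultimately show ?thesis using sumA by (simp add: mult.commute)
  qed
  have "pull_measure Y m x \<noteq> 0" if "x \<in> age Y" for x
    using that pm[OF that] ageD[OF that] M(2) embedding_image by (metis finite_imageI)
  moreover have "pull_measure Y m x = 1" if "verts x = {}" for x
    using that M(1) by (simp add: pull_measure_def)
  ultimately show ?thesis unfolding R_measure_def using Y iso law by blast
qed

subsection \<open>Automorphisms of \<open>times_rat\<close>\<close>

lemma verts_times_rat [simp]: "verts (times_rat X) = verts X \<times> UNIV"
  and idx_times_rat [simp]: "idx (times_rat X) = insert None (Some ` idx X)"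
  by (simp_all add: times_rat_def)

lemma edges_times_rat_None [simp]:
  "((x, y), (x', y')) \<in> edges (times_rat X) None \<longleftrightarrow> x \<in> verts X \<and> x' \<in> verts X \<and> y < y'"
  by (auto simp: times_rat_def)

lemma edges_times_rat_Some [simp]:
  "((x, y), (x', y')) \<in> edges (times_rat X) (Some i) \<longleftrightarrow> (x, x') \<in> edges X i \<and> y = y'"
  by (auto simp: times_rat_def)

text \<open>Homogeneity of the rational line. Adding a largest point \<open>b\<close>, the map found
  so far is kept up to the previous maximum \<open>p\<close> and continued by the line through the
  prescribed values at \<open>p\<close> and \<open>b\<close>; its slope \<open>c\<close> is rational
  and positive, so the map stays onto.\<close>

lemma rat_strict_mono_extend:
  fixes S :: "rat set" and f :: "rat \<Rightarrow> rat"
  assumes "finite S" "strict_mono_on S f"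
  shows "\<exists>h. strict_mono h \<and> surj h \<and> (\<forall>s\<in>S. h s = f s)"
  using assms
proof (induction S rule: finite_linorder_max_induct)
  case empty
  show ?case by (intro exI[of _ "\<lambda>x. x"]) (auto simp: strict_mono_def)
next
  case (insert b A)
  show ?case
  proof (cases "A = {}")
    case True
    have "surj (\<lambda>x. x + (f b - b))" by (metis diff_add_cancel surjI)
    then show ?thesis using True
      by (intro exI[of _ "\<lambda>x. x + (f b - b)"]) (auto simp: strict_mono_def)
  next
    case False
    define p where "p = Max A"
    have pA: "p \<in> A" "\<And>a. a \<in> A \<Longrightarrow> a \<le> p" using insert.hyps(1) False by (auto simp: p_def)
    have "strict_mono_on A f" using insert.prems by (auto simp: strict_mono_on_def)
    then obtain h where h: "strict_mono h" "surj h" "\<And>s. s \<in> A \<Longrightarrow> h s = f s" using insert.IH by blast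
    have pb: "p < b" "f p < f b" using pA insert by (auto simp: strict_mono_on_def)
    define c where "c = (f b - f p) / (b - p)"
    have c: "c > 0" using pb by (simp add: c_def)
    let ?h = "\<lambda>x. if x \<le> p then h x else f p + (x - p) * c"
    have hp: "h p = f p" using h(3) pA by simp
    have "?h x < ?h y" if "x < y" for x y
    proof -
      have "h x \<le> f p" if "x \<le> p" using h(1) that hp by (metis strict_mono_less_eq)
      moreover have "(y - p) * c > 0" if "y > p" using that c by simp
      moreover have "(x - p) * c < (y - p) * c" using \<open>x < y\<close> c by simp
      moreover have "h x < h y" using h(1) \<open>x < y\<close> by (simp add: strict_mono_less)
      ultimately show ?thesis using \<open>x < y\<close> by (auto simp: not_le)
    qed
    then have "strict_mono ?h" by (rule strict_monoI)
    moreover have "surj ?h"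
      unfolding surj_def
    proof
      fix y
      show "\<exists>x. y = ?h x"
      proof (cases "y \<le> f p")
        case True
        obtain x where x: "h x = y" using h(2) by (metis surjD)
        then have "x \<le> p" using True h(1) hp by (metis strict_mono_less_eq)
        then show ?thesis using x by auto
      next
        case False
        then have "(y - f p) / c > 0" using c by simp
        then show ?thesis using c by (intro exI[of _ "p + (y - f p) / c"]) auto
      qed
    qed
    moreover have "?h b = f b" using pb by (simp add: c_def)
    moreover have "?h s = f s" if "s \<in> A" for s using that pA h(3) by auto
    ultimately show ?thesis by (intro exI[of _ ?h]) auto
  qed
qed

text \<open>Two vertices lie on the same level exactly when no \<open>None\<close>-edge joins them
  in either direction. An embedding preserves this and the direction of such edges, so it acts on
  levels by an increasing map.\<close>

lemma level_map:
  assumes f: "embedding G H f" and None: "None \<in> idx G"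
    and G: "\<And>u v. u \<in> verts G \<Longrightarrow> v \<in> verts G \<Longrightarrow> (u, v) \<in> edges G None \<longleftrightarrow> lG u < (lG v :: 'a :: linorder)"
    and H: "\<And>u v. u \<in> verts H \<Longrightarrow> v \<in> verts H \<Longrightarrow> (u, v) \<in> edges H None \<longleftrightarrow> lH u < (lH v :: 'b :: linorder)"
  obtains h where "strict_mono_on (lG ` verts G) h" "\<And>v. v \<in> verts G \<Longrightarrow> lH (f v) = h (lG v)"
proof -
  have less: "lH (f u) < lH (f v) \<longleftrightarrow> lG u < lG v" if "u \<in> verts G" "v \<in> verts G" for u v
    using that embedding_edges[OF f None that] G H embedding_in[OF f] by metis
  then have eq: "lH (f u) = lH (f v)" if "u \<in> verts G" "v \<in> verts G" "lG u = lG v" for u v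
    using that by (metis less_irrefl linorder_neqE)
  define h where "h y = lH (f (SOME v. v \<in> verts G \<and> lG v = y))" for y
  have h: "lH (f v) = h (lG v)" if "v \<in> verts G" for v
  proof -
    have "\<exists>w. w \<in> verts G \<and> lG w = lG v" using that by blast
    from someI_ex[OF this] show ?thesis unfolding h_def using eq that by metis
  qed
  then have "strict_mono_on (lG ` verts G) h" using less by (auto simp: strict_mono_on_def)
  then show thesis using h that by blast
qed

definition sec :: "('v \<times> 'b) set \<Rightarrow> 'b \<Rightarrow> 'v set" where
  "sec T y = {x. (x, y) \<in> T}"

lemma in_sec [simp]: "x \<in> sec T y \<longleftrightarrow> (x, y) \<in> T"
  by (simp add: sec_def)

lemma sec_insert: "sec (insert (x, y) T) z = (if z = y then insert x (sec T z) else sec T z)"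
  by auto

lemma sec_empty: "y \<notin> snd ` T \<Longrightarrow> sec T y = {}"
  by (force simp: sec_def)

lemma finite_sec: assumes "finite T" shows "finite (sec T y)"
proof -
  have "sec T y \<subseteq> fst ` T" by force
  then show ?thesis using assms finite_subset by auto
qed

text \<open>Heights are governed by \<open>level_map\<close>; all other edges join vertices of equal
  height, so each level carries its own isomorphism between subgraphs of \<open>X\<close>.\<close>

lemma times_rat_isomorphism:
  assumes S: "S \<subseteq> verts (times_rat X)" and T: "T \<subseteq> verts (times_rat X)"
    and f: "isomorphism (induced (times_rat X) S) (induced (times_rat X) T) f"
  obtains h where "strict_mono_on (snd ` S) h" "\<And>x y. (x, y) \<in> S \<Longrightarrow> snd (f (x, y)) = h y"
    "\<And>y. y \<in> snd ` S \<Longrightarrow> isomorphism (induced X (sec S y)) (induced X (sec T (h y))) (\<lambda>x. fst (f (x, y)))"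
proof -
  let ?Y = "times_rat X"
  note emb = isomorphism_embedding[OF f]
  obtain h where h: "strict_mono_on (snd ` verts (induced ?Y S)) h"
    "\<And>v. v \<in> verts (induced ?Y S) \<Longrightarrow> snd (f v) = h (snd v)"
  proof (rule level_map[OF emb, of snd snd])
    show "(u, v) \<in> edges (induced ?Y S) None \<longleftrightarrow> snd u < snd v"
      if "u \<in> verts (induced ?Y S)" "v \<in> verts (induced ?Y S)" for u v
      using that S by (cases u; cases v) auto
    show "(u, v) \<in> edges (induced ?Y T) None \<longleftrightarrow> snd u < snd v"
      if "u \<in> verts (induced ?Y T)" "v \<in> verts (induced ?Y T)" for u v
      using that T by (cases u; cases v) auto
  qed auto
  have fe: "f (x, y) = (fst (f (x, y)), h y)" if "(x, y) \<in> S" for x y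
    using h(2)[of "(x, y)"] that by (simp add: prod_eq_iff)
  have im: "f ` S = T" using isomorphism_image[OF f] by simp
  have inj: "inj_on f S" using embedding_inj[OF emb] by simp
  have hinj: "inj_on h (snd ` S)" using h(1) strict_mono_on_imp_inj_on by auto
  have "isomorphism (induced X (sec S y)) (induced X (sec T (h y))) (\<lambda>x. fst (f (x, y)))"
    if y: "y \<in> snd ` S" for y
    unfolding isomorphism_def embedding_def
  proof (intro conjI ballI)
    show "inj_on (\<lambda>x. fst (f (x, y))) (verts (induced X (sec S y)))"
    proof (rule inj_onI)
      fix a b assume "a \<in> verts (induced X (sec S y))" "b \<in> verts (induced X (sec S y))"
        "fst (f (a, y)) = fst (f (b, y))"
      then have "(a, y) \<in> S" "(b, y) \<in> S" "f (a, y) = f (b, y)" using fe[of a y] fe[of b y] by auto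
      then show "a = b" using inj by (auto dest: inj_onD)
    qed
    show im': "(\<lambda>x. fst (f (x, y))) ` verts (induced X (sec S y)) = verts (induced X (sec T (h y)))"
    proof (intro equalityI subsetI)
      fix a assume "a \<in> (\<lambda>x. fst (f (x, y))) ` verts (induced X (sec S y))"
      then obtain x where x: "(x, y) \<in> S" "a = fst (f (x, y))" by auto
      then have "f (x, y) = (a, h y)" using fe[of x y] by simp
      then show "a \<in> verts (induced X (sec T (h y)))" using x(1) im by force
    next
      fix a assume "a \<in> verts (induced X (sec T (h y)))"
      then have "(a, h y) \<in> f ` S" using im by simp
      \<comment> \<open>Injectivity of \<open>h\<close> excludes that a vertex of another level
        lands in this one.\<close>
      then obtain x z where x: "(x, z) \<in> S" "f (x, z) = (a, h y)" by force
      then have "h z = h y" using fe[OF x(1)] by simp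
      then have "z = y" using hinj y x(1) by (metis inj_onD image_eqI snd_conv)
      then show "a \<in> (\<lambda>x. fst (f (x, y))) ` verts (induced X (sec S y))" using x by force
    qed
    then show "(\<lambda>x. fst (f (x, y))) ` verts (induced X (sec S y)) \<subseteq> verts (induced X (sec T (h y)))"
      by simp
    fix i a b
    assume i: "i \<in> idx (induced X (sec S y))" and "a \<in> verts (induced X (sec S y))" "b \<in> verts (induced X (sec S y))"
    then have ab: "(a, y) \<in> S" "(b, y) \<in> S" by auto
    then have fab: "f (a, y) \<in> T" "f (b, y) \<in> T" using im by auto
    have "(f (a, y), f (b, y)) \<in> edges (induced ?Y T) (Some i) \<longleftrightarrow> ((a, y), (b, y)) \<in> edges (induced ?Y S) (Some i)"
      using i ab by (intro embedding_edges[OF emb]) auto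
    moreover have "(f (a, y), f (b, y)) \<in> edges ?Y (Some i) \<longleftrightarrow> (fst (f (a, y)), fst (f (b, y))) \<in> edges X i"
      using fe[OF ab(1)] fe[OF ab(2)] edges_times_rat_Some by metis
    moreover have "fst (f (a, y)) \<in> sec T (h y)" "fst (f (b, y)) \<in> sec T (h y)"
      using fe[OF ab(1)] fe[OF ab(2)] fab by auto
    ultimately show "(a, b) \<in> edges (induced X (sec S y)) i \<longleftrightarrow>
       (fst (f (a, y)), fst (f (b, y))) \<in> edges (induced X (sec T (h y))) i"
      using ab fab by simp
  qed simp
  then show thesis using h that by simp
qed

text \<open>\<open>induced G (verts G)\<close> can differ from \<open>G\<close> as a record, for
  instance at indices outside \<open>idx G\<close>, but isomorphisms do not see this. It makes
  results on induced subgraphs applicable to automorphisms.\<close>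

lemma isomorphism_induced_verts:
  "isomorphism (induced G (verts G)) (induced H (verts H)) f \<longleftrightarrow> isomorphism G H f"
  by (auto simp: isomorphism_def embedding_def) (metis imageI)+

text \<open>The \<open>g y\<close> can be chosen independently, since \<open>None\<close>-edges see
  only heights and all other edges stay within one height.\<close>

lemma times_rat_automorphism:
  assumes h: "strict_mono h" "surj h" and g: "\<And>y. isomorphism X X (g y)"
  shows "isomorphism (times_rat X) (times_rat X) (\<lambda>(x, y). (g y x, h y))"
  unfolding isomorphism_def embedding_def
proof (intro conjI ballI)
  let ?f = "\<lambda>(x, y). (g y x, h y)"
  have inj: "g y a = g y b \<longleftrightarrow> a = b" if "a \<in> verts X" "b \<in> verts X" for y a b
    using that embedding_inj[OF isomorphism_embedding[OF g]] by (auto dest: inj_onD)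
  have gin: "g y a \<in> verts X" if "a \<in> verts X" for y a
    using that embedding_in[OF isomorphism_embedding[OF g]] by auto
  have heq: "h y = h z \<longleftrightarrow> y = z" for y z using h(1) by (simp add: strict_mono_eq)
  show "inj_on ?f (verts (times_rat X))"
    by (auto simp: inj_on_def inj heq)
  show im: "?f ` verts (times_rat X) = verts (times_rat X)"
  proof (intro equalityI subsetI)
    fix v assume "v \<in> verts (times_rat X)"
    then obtain x y where v: "v = (x, y)" "x \<in> verts X" by auto
    obtain z where z: "h z = y" using h(2) by (metis surjD)
    obtain x' where "x' \<in> verts X" "g z x' = x" using isomorphism_image[OF g[of z]] v(2) by (metis imageE)
    then have "v = ?f (x', z)" "(x', z) \<in> verts (times_rat X)" using v z by auto
    then show "v \<in> ?f ` verts (times_rat X)" by (rule image_eqI)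
  qed (auto simp: gin)
  then show "?f ` verts (times_rat X) \<subseteq> verts (times_rat X)" by simp
  fix i u v assume i: "i \<in> idx (times_rat X)" and uv: "u \<in> verts (times_rat X)" "v \<in> verts (times_rat X)"
  have ge: "(g y a, g y b) \<in> edges X j \<longleftrightarrow> (a, b) \<in> edges X j"
    if "j \<in> idx X" "a \<in> verts X" "b \<in> verts X" for j y a b
    using embedding_edges[OF isomorphism_embedding[OF g] that] .
  show "(u, v) \<in> edges (times_rat X) i \<longleftrightarrow> (?f u, ?f v) \<in> edges (times_rat X) i"
    using i uv h(1) by (cases i; cases u; cases v) (auto simp: gin ge heq strict_mono_less)
qed simp

text \<open>A finite isomorphism splits into a map of heights and isomorphisms of levels. The former
  extends to the rationals, the latter extend by homogeneity of \<open>X\<close>, and the pieces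
  reassemble.\<close>

lemma homogeneous_times_rat:
  assumes "homogeneous X" shows "homogeneous (times_rat X)"
  unfolding homogeneous_def
proof (intro ballI allI impI)
  let ?Y = "times_rat X"
  fix G H f assume G: "G \<in> fin_subgraphs ?Y" and H: "H \<in> fin_subgraphs ?Y" and "isomorphism G H f"
  define S where "S = verts G"
  have S: "finite S" "S \<subseteq> verts ?Y" and T: "verts H \<subseteq> verts ?Y"
    unfolding S_def using fin_subgraphsD(1,2)[OF G] fin_subgraphsD(2)[OF H] by blast+
  have "isomorphism (induced ?Y S) (induced ?Y (verts H)) f"
    using \<open>isomorphism G H f\<close> fin_subgraphsD(3)[OF G] fin_subgraphsD(3)[OF H] by (simp add: S_def)
  then obtain h where h: "strict_mono_on (snd ` S) h" "\<And>x y. (x, y) \<in> S \<Longrightarrow> snd (f (x, y)) = h y"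
    "\<And>y. y \<in> snd ` S \<Longrightarrow> isomorphism (induced X (sec S y)) (induced X (sec (verts H) (h y))) (\<lambda>x. fst (f (x, y)))"
    using times_rat_isomorphism[OF S(2) T] by blast
  obtain h' where h': "strict_mono h'" "surj h'" "\<And>y. y \<in> snd ` S \<Longrightarrow> h' y = h y"
    using rat_strict_mono_extend[OF _ h(1)] S(1) by auto
  have "\<exists>g. isomorphism X X g \<and> (\<forall>x. (x, y) \<in> S \<longrightarrow> g x = fst (f (x, y)))" for y
  proof (cases "y \<in> snd ` S")
    case True
    have sub: "sec S y \<subseteq> verts X" "sec (verts H) (h y) \<subseteq> verts X" using S T by auto
    have "embedding (induced X (sec S y)) X (\<lambda>x. fst (f (x, y)))"
      using h(3)[OF True] sub by (simp add: isomorphism_induced_iff)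
    then show ?thesis
      using homogeneous_extend[OF assms, of "induced X (sec S y)" "\<lambda>v. v"] finite_sec[OF S(1)] embedding_incl[OF sub(1)]
      by (metis in_sec verts_induced)
  next
    case False
    then show ?thesis using isomorphism_id by force
  qed
  then obtain g where g: "\<And>y. isomorphism X X (g y)" "\<And>x y. (x, y) \<in> S \<Longrightarrow> g y x = fst (f (x, y))"
    by metis
  have gf: "(\<lambda>(x, y). (g y x, h' y)) v = f v" if "v \<in> verts G" for v
  proof -
    obtain x y where v: "v = (x, y)" by fastforce
    then have xy: "(x, y) \<in> S" using that by (simp add: S_def)
    then have "h' y = h y" using h'(3) by force
    then show ?thesis using g(2)[OF xy] h(2)[OF xy] unfolding v by (simp add: prod_eq_iff)
  qed
  show "\<exists>g. isomorphism ?Y ?Y g \<and> (\<forall>v\<in>verts G. g v = f v)"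
    by (intro exI[of _ "\<lambda>(x, y). (g y x, h' y)"] conjI ballI)
      (rule times_rat_automorphism[OF h'(1,2) g(1)], rule gf)
qed

section \<open>Orbits of points of the product\<close>

text \<open>For finite \<open>L\<close>, the orbit relation of increasing bijections of the
  rationals fixing \<open>L\<close>: each point of \<open>L\<close> is alone, and the other classes
  are the open intervals cut out by \<open>L\<close>.\<close>

definition cuteq :: "rat set \<Rightarrow> rat \<Rightarrow> rat \<Rightarrow> bool" where
  "cuteq L y z \<longleftrightarrow> (\<forall>l\<in>L. (l < y \<longleftrightarrow> l < z) \<and> (y < l \<longleftrightarrow> z < l))"

lemma cuteq_member: "cuteq L y z \<Longrightarrow> y \<in> L \<or> z \<in> L \<Longrightarrow> y = z"
  unfolding cuteq_def by (metis less_irrefl linorder_neqE)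

text \<open>Fixing \<open>S\<close> constrains heights only through the levels of \<open>S\<close>,
  and the movement at height \<open>y\<close> only through \<open>sec S y\<close>; the two
  constraints are independent. Off the levels of \<open>S\<close> that section is empty and any
  automorphism of \<open>X\<close> is allowed.\<close>

lemma point_rel_times_rat:
  assumes S: "finite S" "S \<subseteq> verts (times_rat X)" and x: "x \<in> verts X"
  shows "point_rel (times_rat X) S (x, y) (x', y') \<longleftrightarrow> cuteq (snd ` S) y y' \<and> point_rel X (sec S y) x x'"
    (is "?L \<longleftrightarrow> ?R")
proof
  let ?Y = "times_rat X"
  assume ?L
  then obtain g where g: "isomorphism ?Y ?Y g" "\<And>s. s \<in> S \<Longrightarrow> g s = s" "g (x, y) = (x', y')"
    by (auto simp: point_rel_def auts_def)
  have "isomorphism (induced ?Y (verts ?Y)) (induced ?Y (verts ?Y)) g"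
    using g(1) by (simp only: isomorphism_induced_verts)
  then obtain h where h: "strict_mono_on (snd ` verts ?Y) h" "\<And>x y. (x, y) \<in> verts ?Y \<Longrightarrow> snd (g (x, y)) = h y"
    "\<And>y. y \<in> snd ` verts ?Y \<Longrightarrow>
       isomorphism (induced X (sec (verts ?Y) y)) (induced X (sec (verts ?Y) (h y))) (\<lambda>x. fst (g (x, y)))"
    using times_rat_isomorphism[OF order.refl order.refl] by blast
  have all: "snd ` verts ?Y = UNIV" "\<And>y. sec (verts ?Y) y = verts X" using x by auto
  have mono: "h a < h b \<longleftrightarrow> a < b" for a b
    using h(1) unfolding all(1) by (simp add: strict_mono_less)
  have "h l = l" if l: "l \<in> snd ` S" for l
  proof -
    obtain a where "(a, l) \<in> S" using l by force
    then show ?thesis using h(2)[of a l] g(2)[of "(a, l)"] S(2) by auto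
  qed
  moreover have "h y = y'" using h(2)[of x y] g(3) x by simp
  ultimately have "cuteq (snd ` S) y y'" using mono unfolding cuteq_def by metis
  moreover have "(\<lambda>x. fst (g (x, y))) \<in> auts X (sec S y)"
    using h(3)[of y] all g(2) by (auto simp: auts_def isomorphism_induced_verts)
  then have "point_rel X (sec S y) x x'"
    unfolding point_rel_def by (rule bexI[rotated]) (simp add: g(3))
  ultimately show ?R by blast
next
  assume R: ?R
  then obtain k where k: "isomorphism X X k" "\<And>s. (s, y) \<in> S \<Longrightarrow> k s = s" "k x = x'"
    by (auto simp: point_rel_def auts_def)
  \<comment> \<open>If \<open>y\<close> is itself a level of \<open>S\<close>, then
    \<open>y' = y\<close>, so this map fixes the levels of \<open>S\<close> in every case.\<close>
  let ?f = "\<lambda>z. if z = y then y' else z"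
  have cut: "\<And>l. l \<in> snd ` S \<Longrightarrow> (l < y \<longleftrightarrow> l < y') \<and> (y < l \<longleftrightarrow> y' < l)"
    using R unfolding cuteq_def by blast
  have "finite (insert y (snd ` S))" "strict_mono_on (insert y (snd ` S)) ?f"
    using S(1) cut by (auto simp: strict_mono_on_def)
  from rat_strict_mono_extend[OF this]
  obtain h where h: "strict_mono h" "surj h" "\<And>z. z \<in> insert y (snd ` S) \<Longrightarrow> h z = ?f z"
    by blast
  let ?g = "\<lambda>(a, z). ((if z = y then k else (\<lambda>v. v)) a, h z)"
  have "isomorphism (times_rat X) (times_rat X) ?g"
    by (rule times_rat_automorphism[OF h(1,2)]) (simp add: k(1) isomorphism_id)
  moreover have "?g s = s" if s: "s \<in> S" for s
  proof -
    obtain a z where az: "s = (a, z)" by fastforce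
    then have z: "z \<in> snd ` S" using s by force
    have "y' = y" if "z = y" using cuteq_member[of "snd ` S" y y'] R z that by auto
    then show ?thesis using az h(3)[of z] z k(2)[of a] s by auto
  qed
  moreover have "?g (x, y) = (x', y')" using h(3) k(3) by simp
  ultimately show ?L unfolding point_rel_def auts_def by blast
qed

subsection \<open>The measure on \<open>times_rat\<close>\<close>

lemma finite_between:
  fixes M N :: "rat set"
  assumes "finite M" "finite N" and "\<And>m n. m \<in> M \<Longrightarrow> n \<in> N \<Longrightarrow> m < n"
  obtains t where "\<And>m. m \<in> M \<Longrightarrow> m < t" "\<And>n. n \<in> N \<Longrightarrow> t < n"
proof (cases "M = {} \<or> N = {}")
  case True
  then show thesis
  proof
    assume "M = {}"
    obtain t where "\<forall>n\<in>uminus ` N. n < t" using finite_set_of_finite_maps finite_imageI[OF assms(2)]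
      by (metis Max_ge gt_ex le_less_trans)
    then show thesis using \<open>M = {}\<close> by (intro that[of "- t"]) force+
  next
    assume "N = {}"
    obtain t where "\<forall>m\<in>M. m < t" by (metis Max_ge assms(1) gt_ex le_less_trans)
    then show thesis using \<open>N = {}\<close> by (intro that[of t]) auto
  qed
next
  case False
  then have "Max M < Min N" using assms by simp
  then obtain t where "Max M < t" "t < Min N" using dense by blast
  then show thesis using False assms by (intro that[of t]) auto
qed

text \<open>
  The points of \<open>L\<close> in the open interval around \<open>y\<close> cut it into one more gap than there are points.
  The representatives are a point just below each of them and one above all of them.
\<close>

lemma gap_representatives:
  assumes L: "finite L" "L0 \<subseteq> L" and y: "y \<notin> L0"
  shows "\<exists>J. finite J \<and> J \<subseteq> {z. cuteq L0 y z} - L \<and> card J = card {l \<in> L. cuteq L0 y l} + 1 \<and>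
    (\<forall>z. cuteq L0 y z \<longrightarrow> z \<notin> L \<longrightarrow> (\<exists>!j. j \<in> J \<and> cuteq L j z))"
proof -
  define F where "F = {l \<in> L. cuteq L0 y l}"
  have F: "finite F" "F \<subseteq> L" using L by (auto simp: F_def)
  have convex: "l \<in> F" if "cuteq L0 y a" "cuteq L0 y b" "a < l" "l < b" "l \<in> L" for a b l
  proof -
    have "cuteq L0 y l"
      unfolding cuteq_def
    proof
      fix k assume "k \<in> L0"
      then have "(k < y \<longleftrightarrow> k < a) \<and> (y < k \<longleftrightarrow> a < k)" "(k < y \<longleftrightarrow> k < b) \<and> (y < k \<longleftrightarrow> b < k)"
        using that by (auto simp: cuteq_def)
      moreover have "k \<noteq> y" using y \<open>k \<in> L0\<close> by auto
      ultimately show "(k < y \<longleftrightarrow> k < l) \<and> (y < k \<longleftrightarrow> l < k)" using that(3,4) by force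
    qed
    then show ?thesis using that by (simp add: F_def)
  qed
  \<comment> \<open>By convexity, a point of \<open>L\<close> separating \<open>j\<close> from
    \<open>z\<close> would belong to \<open>F\<close>; off \<open>L\<close>, agreement on
    \<open>F\<close> is therefore agreement on \<open>L\<close>.\<close>
  have same: "cuteq L j z" if "cuteq L0 y j" "j \<notin> L" "cuteq L0 y z" "z \<notin> L"
    "\<And>f. f \<in> F \<Longrightarrow> f < j \<longleftrightarrow> f < z" for j z
    unfolding cuteq_def
  proof
    fix l assume l: "l \<in> L"
    then have "l \<noteq> j" "l \<noteq> z" using that by auto
    moreover have "l < j \<longleftrightarrow> l < z"
      using convex[OF that(1,3) _ _ l] convex[OF that(3,1) _ _ l] that(5)[of l] \<open>l \<noteq> j\<close> \<open>l \<noteq> z\<close>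
      by (metis linorder_neqE)
    ultimately show "(l < j \<longleftrightarrow> l < z) \<and> (j < l \<longleftrightarrow> z < l)" by (metis linorder_neqE less_asym)
  qed
  \<comment> \<open>Such a point has nothing of \<open>L\<close> between itself and
    \<open>a\<close>; as \<open>L0\<close> is part of \<open>L\<close>, it stays inside the interval
    around \<open>y\<close>.\<close>
  have "\<exists>u. u < a \<and> (\<forall>l\<in>L. l < a \<longrightarrow> l < u)" if "a \<in> F" for a
  proof -
    obtain u where "\<And>l. l \<in> {l \<in> L. l < a} \<Longrightarrow> l < u" "\<And>n. n \<in> {a} \<Longrightarrow> u < n"
      by (rule finite_between[of "{l \<in> L. l < a}" "{a}"]) (use L in auto)
    then show ?thesis by auto
  qed
  then obtain p where p: "\<And>a. a \<in> F \<Longrightarrow> p a < a" "\<And>a l. a \<in> F \<Longrightarrow> l \<in> L \<Longrightarrow> l < a \<Longrightarrow> l < p a"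
    by metis
  have pI: "cuteq L0 y (p a)" "p a \<notin> L" if a: "a \<in> F" for a
  proof -
    show "cuteq L0 y (p a)"
      unfolding cuteq_def
    proof
      fix k assume k: "k \<in> L0"
      then have "(k < y \<longleftrightarrow> k < a) \<and> (y < k \<longleftrightarrow> a < k)" "k \<noteq> y" "k \<in> L"
        using a y L by (auto simp: F_def cuteq_def)
      then show "(k < y \<longleftrightarrow> k < p a) \<and> (y < k \<longleftrightarrow> p a < k)"
        using p(1)[OF a] p(2)[OF a, of k] by force
    qed
    show "p a \<notin> L" using p(1)[OF a] p(2)[OF a, of "p a"] by auto
  qed
  \<comment> \<open>Including \<open>y\<close> among the lower bounds keeps \<open>t\<close> inside
    the interval even when \<open>F\<close> is empty.\<close>
  obtain t where t: "\<And>m. m \<in> insert y F \<Longrightarrow> m < t" "\<And>n. n \<in> {k \<in> L0. y < k} \<Longrightarrow> t < n"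
  proof (rule finite_between[of "insert y F" "{k \<in> L0. y < k}"])
    show "finite {k \<in> L0. y < k}" using finite_subset[OF L(2,1)] by simp
    show "m < n" if "m \<in> insert y F" "n \<in> {k \<in> L0. y < k}" for m n
      using that by (auto simp: F_def cuteq_def)
  qed (use F that in auto)
  have tI: "cuteq L0 y t"
    unfolding cuteq_def
  proof
    fix k assume k: "k \<in> L0"
    then have "k \<noteq> y" using y by auto
    then show "(k < y \<longleftrightarrow> k < t) \<and> (y < k \<longleftrightarrow> t < k)" using t(1)[of y] t(2)[of k] k by force
  qed
  have tL: "t \<notin> L" using tI t(1)[of t] by (auto simp: F_def)
  define J where "J = insert t (p ` F)"
  have sep: "j = j'" if "j \<in> J" "j' \<in> J" "\<And>f. f \<in> F \<Longrightarrow> f < j \<longleftrightarrow> f < j'" for j j'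
  proof -
    have pp: "a = b" if "a \<in> F" "b \<in> F" "\<And>f. f \<in> F \<Longrightarrow> f < p a \<longleftrightarrow> f < p b" for a b
      using p(1)[OF that(1)] p(1)[OF that(2)] p(2)[OF that(1), of b] p(2)[OF that(2), of a] that F
      by (metis less_asym linorder_neqE subsetD)
    have pt: False if "a \<in> F" "\<And>f. f \<in> F \<Longrightarrow> f < p a \<longleftrightarrow> f < t" for a
      using that(2)[OF that(1)] p(1)[OF that(1)] t(1)[of a] that(1) by auto
    show ?thesis using that pp pt unfolding J_def by blast
  qed
  have "inj_on p F" unfolding inj_on_def
  proof (intro ballI impI)
    fix a b assume ab: "a \<in> F" "b \<in> F" "p a = p b"
    show "a = b"
      using p(1)[OF ab(1)] p(1)[OF ab(2)] p(2)[OF ab(1), of b] p(2)[OF ab(2), of a] ab F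
      by (metis less_asym linorder_neqE subsetD)
  qed
  moreover have "t \<notin> p ` F" using t(1) p(1) by (metis imageE insertI2 less_asym)
  ultimately have card: "card J = card F + 1" using F by (simp add: J_def card_image)
  have "\<exists>!j. j \<in> J \<and> cuteq L j z" if z: "cuteq L0 y z" "z \<notin> L" for z
  proof -
    \<comment> \<open>\<open>z\<close> is represented by the point just below the least element of
      \<open>F\<close> above it, or by \<open>t\<close> when there is none.\<close>
    have "\<exists>j\<in>J. cuteq L j z"
    proof (cases "\<exists>f\<in>F. z < f")
      case True
      define a where "a = Min {f \<in> F. z < f}"
      have "a \<in> {f \<in> F. z < f}" unfolding a_def using True F by (intro Min_in) auto
      moreover have "a \<le> f" if "f \<in> F" "z < f" for f unfolding a_def using that F by simp
      ultimately have a: "a \<in> F" "z < a" "\<And>f. f \<in> F \<Longrightarrow> z < f \<Longrightarrow> a \<le> f" by auto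
      have "f < p a \<longleftrightarrow> f < z" if "f \<in> F" for f
        using a(3)[OF that] p(1)[OF a(1)] p(2)[OF a(1), of f] a(2) that F z(2)
        by (metis less_trans linorder_neqE not_le subsetD)
      then have "cuteq L (p a) z" using same pI[OF a(1)] z by blast
      then show ?thesis using a(1) by (auto simp: J_def)
    next
      case False
      have "f < t \<longleftrightarrow> f < z" if "f \<in> F" for f
        using False t(1) that F z(2) by (metis insertI2 linorder_neqE subsetD)
      then have "cuteq L t z" using same tI tL z by blast
      then show ?thesis by (auto simp: J_def)
    qed
    moreover have "j = j'" if "j \<in> J" "j' \<in> J" "cuteq L j z" "cuteq L j' z" for j j'
      using that F by (intro sep) (auto simp: cuteq_def)
    ultimately show ?thesis by blast
  qed
  moreover have "J \<subseteq> {z. cuteq L0 y z} - L" using pI tI tL by (auto simp: J_def)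
  moreover have "finite J" using F by (simp add: J_def)
  ultimately show ?thesis using card unfolding F_def by blast
qed

section \<open>The signed product over levels and its one-point law\<close>

definition lex_measure :: "('v set \<Rightarrow> 'k::field) \<Rightarrow> ('v \<times> rat) set \<Rightarrow> 'k" where
  "lex_measure m T = (\<Prod>y\<in>snd ` T. - m (sec T y))"

text \<open>Only the factor at level \<open>y\<close> changes; cross-multiplication stands for the
  quotient of its new and old values.\<close>

lemma lex_measure_insert_old:
  assumes S: "finite S" and y: "y \<in> snd ` S"
  shows "lex_measure m (insert (x, y) S) * m (sec S y) = lex_measure m S * m (insert x (sec S y))"
proof -
  let ?L = "snd ` S - {y}"
  have "snd ` insert (x, y) S = snd ` S" using y by auto
  then have "lex_measure m (insert (x, y) S) = - m (insert x (sec S y)) * (\<Prod>z\<in>?L. - m (sec (insert (x, y) S) z))"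
    unfolding lex_measure_def using S y by (simp add: prod.remove[of _ y] sec_insert)
  also have "(\<Prod>z\<in>?L. - m (sec (insert (x, y) S) z)) = (\<Prod>z\<in>?L. - m (sec S z))"
    by (intro prod.cong) (auto simp: sec_insert)
  moreover have "lex_measure m S = - m (sec S y) * (\<Prod>z\<in>?L. - m (sec S z))"
    unfolding lex_measure_def using S y by (simp add: prod.remove[of _ y])
  ultimately show ?thesis by simp
qed

lemma lex_measure_insert_new:
  assumes S: "finite S" and y: "y \<notin> snd ` S"
  shows "lex_measure m (insert (x, y) S) = - m {x} * lex_measure m S"
proof -
  have "(\<Prod>z\<in>snd ` S. - m (sec (insert (x, y) S) z)) = (\<Prod>z\<in>snd ` S. - m (sec S z))"
    using y by (intro prod.cong) (auto simp: sec_insert)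
  then show ?thesis
    unfolding lex_measure_def using S y by (simp add: sec_insert sec_empty)
qed

lemma set_measure_isomorphism:
  assumes m: "set_measure X m" and hom: "homogeneous X"
    and A: "finite A" "A \<subseteq> verts X" and B: "B \<subseteq> verts X"
    and f: "isomorphism (induced X A) (induced X B) f"
  shows "m B = m A"
proof -
  have "embedding (induced X A) X f" "f ` A = B" using f B by (auto simp: isomorphism_induced_iff)
  then obtain g where g: "isomorphism X X g" "\<And>v. v \<in> A \<Longrightarrow> g v = f v"
    using homogeneous_extend[OF hom, of "induced X A" "\<lambda>v. v" f] A embedding_incl[OF A(2)]
    by (metis verts_induced)
  then have "g ` A = B" using \<open>f ` A = B\<close> by (metis image_cong)
  then show ?thesis using set_measureD(3)[OF m A g(1)] by simp
qed

lemma lex_measure_automorphism: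
  assumes m: "set_measure X m" and hom: "homogeneous X"
    and T: "finite T" "T \<subseteq> verts (times_rat X)" and g: "isomorphism (times_rat X) (times_rat X) g"
  shows "lex_measure m (g ` T) = lex_measure m T"
proof -
  have gT: "g ` T \<subseteq> verts (times_rat X)" using T embedding_in[OF isomorphism_embedding[OF g]] by blast
  have "isomorphism (induced (times_rat X) T) (induced (times_rat X) (g ` T)) g"
    unfolding isomorphism_induced_iff[OF gT]
    using embedding_induced_dom[OF isomorphism_embedding[OF g] T(2)] by simp
  then obtain h where h: "strict_mono_on (snd ` T) h" "\<And>x y. (x, y) \<in> T \<Longrightarrow> snd (g (x, y)) = h y"
    "\<And>y. y \<in> snd ` T \<Longrightarrow> isomorphism (induced X (sec T y)) (induced X (sec (g ` T) (h y))) (\<lambda>x. fst (g (x, y)))"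
    using times_rat_isomorphism[OF T(2) gT] by metis
  have im: "snd ` g ` T = h ` snd ` T" using h(2) by (force simp: image_image)
  have "m (sec (g ` T) (h y)) = m (sec T y)" if "y \<in> snd ` T" for y
  proof (rule set_measure_isomorphism[OF m hom finite_sec[OF T(1)] _ _ h(3)[OF that]])
    show "sec T y \<subseteq> verts X" "sec (g ` T) (h y) \<subseteq> verts X" using T(2) gT by (auto simp: sec_def)
  qed
  then show ?thesis
    unfolding lex_measure_def im using strict_mono_on_imp_inj_on[OF h(1)] by (simp add: prod.reindex)
qed

text \<open>Orbits are represented by pairs: a height \<open>j\<close> from \<open>K\<close> and, at
  that height, a point of \<open>B j\<close> supplied by the law of \<open>X\<close>. The sum splits
  accordingly into the contributions \<open>W j\<close> of the heights.\<close>

lemma lex_measure_law: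
  assumes m: "set_measure X m"
    and S: "finite S" "S \<subseteq> verts (times_rat X)" "S0 \<subseteq> S" and x: "x \<in> verts X"
  shows "\<exists>C. transversal (point_rel (times_rat X) S) {q. point_rel (times_rat X) S0 (x, y) q} C \<and>
    (\<Sum>c\<in>C. lex_measure m (insert c S)) * lex_measure m S0 = lex_measure m (insert (x, y) S0) * lex_measure m S"
proof -
  let ?Y = "times_rat X"
  note M = set_measureD[OF m]
  have S0: "finite S0" "S0 \<subseteq> verts ?Y" using S finite_subset by auto
  define L where "L = snd ` S"
  define L0 where "L0 = snd ` S0"
  define F where "F = {l \<in> L. cuteq L0 y l}"
  have L: "finite L" "L0 \<subseteq> L" and F: "finite F" using S by (auto simp: L_def L0_def F_def)
  \<comment> \<open>If \<open>y\<close> is a level of \<open>S0\<close>, its class of heights is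
    just \<open>y\<close> and there is no gap; otherwise gaps outnumber levels by one.\<close>
  have "\<exists>J. finite J \<and> J \<subseteq> {z. cuteq L0 y z} - L \<and> card J = (if y \<in> L0 then 0 else card F + 1) \<and>
    (\<forall>z. cuteq L0 y z \<longrightarrow> z \<notin> L \<longrightarrow> (\<exists>!j. j \<in> J \<and> cuteq L j z))"
  proof (cases "y \<in> L0")
    case True
    then have "z \<in> L" if "cuteq L0 y z" for z using cuteq_member[OF that] L by auto
    then show ?thesis using True by (intro exI[of _ "{}"]) auto
  next
    case False
    then show ?thesis using gap_representatives[OF L False] by (simp add: F_def)
  qed
  then obtain J where J: "finite J" "J \<subseteq> {z. cuteq L0 y z} - L" "card J = (if y \<in> L0 then 0 else card F + 1)"
    "\<And>z. cuteq L0 y z \<Longrightarrow> z \<notin> L \<Longrightarrow> (\<exists>!j. j \<in> J \<and> cuteq L j z)" by blast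
  define K where "K = F \<union> J"
  have finK: "finite K" using F J by (simp add: K_def)
  have KI: "cuteq L0 y j" if "j \<in> K" for j using that J by (auto simp: K_def F_def)
  have K: "\<exists>!j. j \<in> K \<and> cuteq L j z" if z: "cuteq L0 y z" for z
  proof (cases "z \<in> L")
    case True
    then have "z \<in> K" "cuteq L z z" using z by (auto simp: K_def F_def cuteq_def)
    then show ?thesis using True cuteq_member[of L _ z] by blast
  next
    case False
    have "\<not> cuteq L j z" if "j \<in> F" for j
      using that cuteq_member[of L j z] False by (auto simp: F_def)
    then show ?thesis using J(4)[OF z False] unfolding K_def by blast
  qed
  \<comment> \<open>Either \<open>j = y\<close>, or neither of them is a level of \<open>S0\<close>
    and both sections are empty.\<close>
  have sec0: "sec S0 j = sec S0 y" if "cuteq L0 y j" for j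
    using that cuteq_member[OF that] sec_empty unfolding L0_def by metis
  have "\<forall>j. \<exists>B. transversal (point_rel X (sec S j)) {q. point_rel X (sec S0 j) x q} B \<and>
      (\<Sum>b\<in>B. m (insert b (sec S j))) * m (sec S0 j) = m (insert x (sec S0 j)) * m (sec S j)"
    using S x by (intro allI M(4) finite_sec) auto
  then obtain B where B: "\<And>j. transversal (point_rel X (sec S j)) {q. point_rel X (sec S0 j) x q} (B j)"
    and sumB: "\<And>j. (\<Sum>b\<in>B j. m (insert b (sec S j))) * m (sec S0 j) = m (insert x (sec S0 j)) * m (sec S j)"
    by metis
  have finB: "finite (B j)" and Bsub: "\<And>b. b \<in> B j \<Longrightarrow> point_rel X (sec S0 j) x b" for j
    using B[of j] by (auto simp: transversal_def)
  have Bex: "\<exists>!b. b \<in> B j \<and> point_rel X (sec S j) b q" if "point_rel X (sec S0 j) x q" for j q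
    using B[of j] that by (simp add: transversal_def)
  \<comment> \<open>\<open>Sigma\<close> puts the height first, a vertex of the product puts it
    second.\<close>
  define C where "C = prod.swap ` Sigma K B"
  have C: "(b, j) \<in> C \<longleftrightarrow> j \<in> K \<and> b \<in> B j" for b j by (force simp: C_def)
  have relS: "point_rel ?Y S (b, j) (x', y') \<longleftrightarrow> cuteq L j y' \<and> point_rel X (sec S j) b x'"
    if "(b, j) \<in> C" for b j x' y'
    using that point_rel_times_rat[OF S(1,2)] point_rel_in[OF Bsub x] by (auto simp: C L_def)
  have relS0: "point_rel ?Y S0 (x, y) (x', y') \<longleftrightarrow> cuteq L0 y y' \<and> point_rel X (sec S0 y) x x'" for x' y'
    using point_rel_times_rat[OF S0 x] by (simp add: L0_def)
  have tr: "transversal (point_rel ?Y S) {q. point_rel ?Y S0 (x, y) q} C"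
    unfolding transversal_def
  proof (intro conjI ballI)
    show "finite C" using finK finB by (simp add: C_def)
    show "C \<subseteq> {q. point_rel ?Y S0 (x, y) q}"
    proof
      fix c assume c: "c \<in> C"
      obtain b j where bj: "c = (b, j)" by fastforce
      then have "j \<in> K" "b \<in> B j" using c C by auto
      then have "cuteq L0 y j" "point_rel X (sec S0 y) x b" using KI Bsub[of b j] sec0 by auto
      then show "c \<in> {q. point_rel ?Y S0 (x, y) q}" using relS0 bj by simp
    qed
    fix q assume "q \<in> {q. point_rel ?Y S0 (x, y) q}"
    moreover obtain x' y' where q: "q = (x', y')" by fastforce
    ultimately have q': "cuteq L0 y y'" "point_rel X (sec S0 y) x x'" using relS0 by auto
    obtain j where j: "j \<in> K" "cuteq L j y'" and j1: "\<And>j'. j' \<in> K \<Longrightarrow> cuteq L j' y' \<Longrightarrow> j' = j"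
      using K[OF q'(1)] by blast
    have "point_rel X (sec S0 j) x x'" using q'(2) sec0[OF KI[OF j(1)]] by simp
    then obtain b where b: "b \<in> B j" "point_rel X (sec S j) b x'"
      and b1: "\<And>b'. b' \<in> B j \<Longrightarrow> point_rel X (sec S j) b' x' \<Longrightarrow> b' = b" using Bex by blast
    show "\<exists>!c. c \<in> C \<and> point_rel ?Y S c q"
    proof (rule ex1I)
      show "(b, j) \<in> C \<and> point_rel ?Y S (b, j) q" using relS j b C q by auto
      fix c assume c: "c \<in> C \<and> point_rel ?Y S c q"
      obtain b' j' where bj: "c = (b', j')" by fastforce
      then have "cuteq L j' y'" "point_rel X (sec S j') b' x'" "j' \<in> K" "b' \<in> B j'"
        using c relS q C by auto
      then show "c = (b, j)" using j1[of j'] b1[of b'] bj by auto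
    qed
  qed
  define W where "W j = (\<Sum>b\<in>B j. lex_measure m (insert (b, j) S))" for j
  have sumC: "(\<Sum>c\<in>C. lex_measure m (insert c S)) = sum W K"
    unfolding C_def W_def using finK finB
    by (subst sum.reindex) (simp_all add: sum.Sigma case_prod_beta prod.swap_def)
  have nz: "m (sec S j) \<noteq> 0" "m (sec S0 j) \<noteq> 0" for j
    using S S0 by (intro M(2) finite_sec; auto)+
  \<comment> \<open>The law of \<open>X\<close> is applied on level \<open>j\<close>; the factor
    \<open>m (sec S j)\<close> that it introduces cancels.\<close>
  have old: "W j * m (sec S0 y) = lex_measure m S * m (insert x (sec S0 y))" if "j \<in> F" for j
  proof -
    have jS: "j \<in> snd ` S" and sj: "sec S0 j = sec S0 y" using that sec0 by (auto simp: F_def L_def)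
    have WS: "W j * m (sec S j) = lex_measure m S * (\<Sum>b\<in>B j. m (insert b (sec S j)))"
      unfolding W_def sum_distrib_right sum_distrib_left lex_measure_insert_old[OF S(1) jS] ..
    have "W j * m (sec S0 y) * m (sec S j) = W j * m (sec S j) * m (sec S0 j)"
      unfolding sj by (simp only: mult_ac)
    also have "\<dots> = lex_measure m S * ((\<Sum>b\<in>B j. m (insert b (sec S j))) * m (sec S0 j))"
      unfolding WS by (simp only: mult_ac)
    also have "\<dots> = lex_measure m S * m (insert x (sec S0 y)) * m (sec S j)"
      unfolding sumB unfolding sj by (simp only: mult_ac)
    finally show ?thesis using nz by simp
  qed
  have new: "W j = - lex_measure m S * m {x}" if "j \<in> J" "y \<notin> L0" for j
  proof -
    have jS: "j \<notin> snd ` S" and "sec S0 j = sec S0 y" using that J(2) sec0 by (auto simp: L_def)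
    moreover have "sec S0 y = {}" using that(2) unfolding L0_def by (rule sec_empty)
    ultimately have "sec S j = {}" "sec S0 j = {}" using sec_empty[OF jS] by simp_all
    then have "(\<Sum>b\<in>B j. m {b}) = m {x}" using sumB[of j] M(1) by simp
    moreover have "W j = - lex_measure m S * (\<Sum>b\<in>B j. m {b})"
      unfolding W_def lex_measure_insert_new[OF S(1) jS] by (simp add: sum_distrib_left sum_negf mult.commute)
    ultimately show ?thesis by simp
  qed
  have "sum W K * lex_measure m S0 = lex_measure m (insert (x, y) S0) * lex_measure m S"
  proof (cases "y \<in> L0")
    case True
    have "F = {y}" using True cuteq_member[of L0 y] L by (auto simp: F_def cuteq_def)
    moreover have "J = {}" using J(1,3) True by simp
    ultimately have W: "sum W K * m (sec S0 y) = lex_measure m S * m (insert x (sec S0 y))"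
      using old by (simp add: K_def)
    have I: "lex_measure m (insert (x, y) S0) * m (sec S0 y) = lex_measure m S0 * m (insert x (sec S0 y))"
      using lex_measure_insert_old[OF S0(1)] True by (simp add: L0_def)
    have "sum W K * lex_measure m S0 * m (sec S0 y) = sum W K * m (sec S0 y) * lex_measure m S0"
      by (simp only: mult_ac)
    also have "\<dots> = lex_measure m S0 * m (insert x (sec S0 y)) * lex_measure m S"
      unfolding W by (simp only: mult_ac)
    also have "\<dots> = lex_measure m (insert (x, y) S0) * lex_measure m S * m (sec S0 y)"
      unfolding I[symmetric] by (simp only: mult_ac)
    finally have "sum W K * lex_measure m S0 * m (sec S0 y) =
        lex_measure m (insert (x, y) S0) * lex_measure m S * m (sec S0 y)" .
    then show ?thesis using nz by simp
  next
    case False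
    then have sy: "sec S0 y = {}" by (simp add: sec_empty L0_def)
    have "sum W K = sum W F + sum W J" unfolding K_def using F J by (intro sum.union_disjoint) (auto simp: F_def)
    also have "sum W F = of_nat (card F) * (lex_measure m S * m {x})"
      using old sy M(1) by simp
    also have "sum W J = of_nat (card F + 1) * - (lex_measure m S * m {x})"
      using new False J(3) by simp
    finally have "sum W K = - lex_measure m S * m {x}" by (simp add: algebra_simps)
    moreover have "lex_measure m (insert (x, y) S0) = - m {x} * lex_measure m S0"
      using lex_measure_insert_new[OF S0(1)] False by (simp add: L0_def)
    ultimately show ?thesis by (simp add: mult_ac)
  qed
  then show ?thesis using tr sumC by auto
qed

lemma set_measure_lex_measure:
  assumes m: "set_measure X m" and hom: "homogeneous X"
  shows "set_measure (times_rat X) (lex_measure m)"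
proof -
  note M = set_measureD[OF m]
  have "lex_measure m T \<noteq> 0" if "finite T" "T \<subseteq> verts (times_rat X)" for T
  proof -
    have "m (sec T y) \<noteq> 0" for y using that by (intro M(2) finite_sec) auto
    then show ?thesis using that by (simp add: lex_measure_def)
  qed
  then show ?thesis
    unfolding set_measure_def
    using lex_measure_automorphism[OF m hom] lex_measure_law[OF m] by (auto simp: lex_measure_def[of m "{}"])
qed

subsection \<open>Sequences of graphs\<close>

lemma verts_seq_graph [simp]:
  "verts (seq_graph I xs) = {(a, v). a < length xs \<and> v \<in> verts (xs ! a)}"
  and idx_seq_graph [simp]: "idx (seq_graph I xs) = insert None (Some ` I)"
  by (simp_all add: seq_graph_def Let_def)

lemma edges_seq_graph_None [simp]:
  "((a, u), (b, v)) \<in> edges (seq_graph I xs) None \<longleftrightarrow>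
     a < length xs \<and> u \<in> verts (xs ! a) \<and> b < length xs \<and> v \<in> verts (xs ! b) \<and> a < b"
  by (auto simp: seq_graph_def Let_def)

lemma edges_seq_graph_Some [simp]:
  "((a, u), (b, v)) \<in> edges (seq_graph I xs) (Some i) \<longleftrightarrow> a = b \<and> a < length xs \<and> (u, v) \<in> edges (xs ! a) i"
  by (auto simp: seq_graph_def Let_def)

text \<open>
  The image of \<open>seq_graph\<close> in \<open>times_rat\<close> when the \<open>a\<close>-th graph is embedded by \<open>d a\<close> at height \<open>e a\<close>.
\<close>

definition place :: "(nat \<Rightarrow> 'w \<Rightarrow> 'v) \<Rightarrow> (nat \<Rightarrow> rat) \<Rightarrow> ('w, 'i) mgraph list \<Rightarrow> ('v \<times> rat) set" where
  "place d e xs = (\<lambda>(a, v). (d a v, e a)) ` {(a, v). a < length xs \<and> v \<in> verts (xs ! a)}"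

lemma in_place: "(x, y) \<in> place d e xs \<longleftrightarrow> (\<exists>a<length xs. y = e a \<and> x \<in> d a ` verts (xs ! a))"
  by (force simp: place_def)

lemma sec_place:
  assumes "strict_mono_on {..<length xs} e" "a < length xs"
  shows "sec (place d e xs) (e a) = d a ` verts (xs ! a)"
proof -
  have "b = a" if "b < length xs" "e a = e b" for b
    using strict_mono_on_imp_inj_on[OF assms(1)] that assms(2) by (auto dest: inj_onD)
  then show ?thesis using assms(2) by (intro set_eqI) (simp add: in_place, blast)
qed

lemma snd_place:
  assumes "\<And>x. x \<in> set xs \<Longrightarrow> verts x \<noteq> {}"
  shows "snd ` place d e xs = e ` {..<length xs}"
proof -
  have "\<exists>v. v \<in> verts (xs ! a)" if "a < length xs" for a using assms that by (meson nth_mem ex_in_conv)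
  then show ?thesis by (force simp: place_def image_image)
qed

text \<open>Increasing heights turn the order of the list into \<open>None\<close>-edges, and each
  \<open>d a\<close> carries the edges of its entry. Heights are left free because both 0, 1, 2, ...
  and the actual levels of a given subgraph will be used.\<close>

lemma embedding_place:
  assumes e: "strict_mono_on {..<length xs} e"
    and d: "\<And>a. a < length xs \<Longrightarrow> embedding (xs ! a) X (d a)"
  shows "embedding (seq_graph (idx X) xs) (times_rat X) (\<lambda>(a, v). (d a v, e a))"
    and "place d e xs \<subseteq> verts (times_rat X)"
    and "isomorphic (seq_graph (idx X) xs) (induced (times_rat X) (place d e xs))"
proof -
  let ?f = "\<lambda>(a, v). (d a v, e a)"
  have eq: "e a = e b \<longleftrightarrow> a = b" "e a < e b \<longleftrightarrow> a < b" if "a < length xs" "b < length xs" for a b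
    using that e strict_mono_on_eqD[OF e] strict_mono_on_less[OF e] by auto
  have din: "d a v \<in> verts X" if "a < length xs" "v \<in> verts (xs ! a)" for a v
    using embedding_in[OF d that(2)] that(1) by blast
  have dinj: "d a u = d a v \<longleftrightarrow> u = v" if "a < length xs" "u \<in> verts (xs ! a)" "v \<in> verts (xs ! a)" for a u v
    using embedding_inj[OF d[OF that(1)]] that by (auto dest: inj_onD)
  have dedge: "(d a u, d a v) \<in> edges X i \<longleftrightarrow> (u, v) \<in> edges (xs ! a) i"
    if "a < length xs" "u \<in> verts (xs ! a)" "v \<in> verts (xs ! a)" "i \<in> idx X" for a u v i
    using embedding_edges[OF d[OF that(1)] _ that(2,3)] embedding_idx[OF d[OF that(1)]] that(4) by simp
  show emb: "embedding (seq_graph (idx X) xs) (times_rat X) ?f"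
    unfolding embedding_def
  proof (intro conjI ballI)
    show "inj_on ?f (verts (seq_graph (idx X) xs))" by (auto simp: inj_on_def eq dinj)
    show "?f ` verts (seq_graph (idx X) xs) \<subseteq> verts (times_rat X)" by (auto simp: din)
    fix i u v assume "i \<in> idx (seq_graph (idx X) xs)" "u \<in> verts (seq_graph (idx X) xs)"
      "v \<in> verts (seq_graph (idx X) xs)"
    then show "(u, v) \<in> edges (seq_graph (idx X) xs) i \<longleftrightarrow> (?f u, ?f v) \<in> edges (times_rat X) i"
      by (cases i; cases u; cases v) (auto simp: eq din dedge)
  qed simp
  have im: "?f ` verts (seq_graph (idx X) xs) = place d e xs" by (simp add: place_def)
  show "place d e xs \<subseteq> verts (times_rat X)"
    using embedding_image[OF emb] unfolding im .
  show "isomorphic (seq_graph (idx X) xs) (induced (times_rat X) (place d e xs))"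
    using isomorphic_induced_image[OF emb] unfolding im .
qed

lemma finite_place: "(\<And>x. x \<in> set xs \<Longrightarrow> finite (verts x)) \<Longrightarrow> finite (place d e xs)"
proof -
  assume *: "\<And>x. x \<in> set xs \<Longrightarrow> finite (verts x)"
  have "{(a, v). a < length xs \<and> v \<in> verts (xs ! a)} = Sigma {..<length xs} (\<lambda>a. verts (xs ! a))" by auto
  then show ?thesis using * by (auto simp: place_def intro!: finite_SigmaI)
qed

lemma strict_mono_rat_of_nat: "strict_mono_on A (of_nat :: nat \<Rightarrow> rat)"
  by (simp add: strict_mono_on_def)

text \<open>Placed at the same heights, \<open>xs\<close> through isomorphisms onto the entries of
  \<open>ys\<close> and \<open>ys\<close> by inclusion, the two lists occupy the same vertex set of
  the product.\<close>

lemma isomorphic_seq_graphI: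
  assumes l: "list_all2 isomorphic xs ys" and ys: "set ys \<subseteq> fin_subgraphs X"
  shows "isomorphic (seq_graph (idx X) xs) (seq_graph (idx X) ys)"
proof -
  have len: "length xs = length ys" using l by (rule list_all2_lengthD)
  have "\<exists>f. isomorphism (xs ! a) (ys ! a) f" if "a < length xs" for a
    using list_all2_nthD[OF l that] by (simp add: isomorphic_def)
  then obtain d where d: "\<And>a. a < length xs \<Longrightarrow> isomorphism (xs ! a) (ys ! a) (d a)" by metis
  have ys': "embedding (ys ! a) X (\<lambda>v. v)" if "a < length ys" for a
    using fin_subgraphsD(5) that ys nth_mem by blast
  have "embedding (xs ! a) X (d a)" if "a < length xs" for a
    using embedding_comp[OF isomorphism_embedding[OF d[OF that]] ys'] that len by simp
  then have 1: "isomorphic (seq_graph (idx X) xs) (induced (times_rat X) (place d of_nat xs))"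
    by (rule embedding_place(3)[OF strict_mono_rat_of_nat])
  have 2: "isomorphic (seq_graph (idx X) ys) (induced (times_rat X) (place (\<lambda>a v. v) of_nat ys))"
    by (rule embedding_place(3)[OF strict_mono_rat_of_nat ys'])
  have "p \<in> place d of_nat xs \<longleftrightarrow> p \<in> place (\<lambda>a v. v) of_nat ys" for p
    by (cases p) (simp add: in_place isomorphism_image[OF d] len cong: conj_cong)
  then have "place d of_nat xs = place (\<lambda>a v. v) of_nat ys" by blast
  then show ?thesis using 1 2 isomorphic_trans isomorphic_sym by metis
qed

text \<open>Both lists are placed at heights 0, 1, 2, .... An increasing bijection between initial
  segments of the naturals is the identity, so levels are matched position by position. Non-empty
  entries make every position visible as a level.\<close>

lemma isomorphic_seq_graphD:
  assumes iso: "isomorphic (seq_graph (idx X) xs) (seq_graph (idx X) ys)"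
    and xs: "set xs \<subseteq> {x \<in> fin_subgraphs X. verts x \<noteq> {}}" and ys: "set ys \<subseteq> {x \<in> fin_subgraphs X. verts x \<noteq> {}}"
  shows "list_all2 isomorphic xs ys"
proof -
  let ?Y = "times_rat X"
  let ?e = "of_nat :: nat \<Rightarrow> rat"
  define P where "P zs = place (\<lambda>a v. v) ?e zs" for zs :: "('a, 'b) mgraph list"
  have P: "P zs \<subseteq> verts ?Y" "isomorphic (seq_graph (idx X) zs) (induced ?Y (P zs))"
    "snd ` P zs = ?e ` {..<length zs}"
    "\<And>a. a < length zs \<Longrightarrow> induced X (sec (P zs) (?e a)) = zs ! a"
    if zs: "set zs \<subseteq> {x \<in> fin_subgraphs X. verts x \<noteq> {}}" for zs
  proof -
    have emb: "embedding (zs ! a) X (\<lambda>v. v)" if "a < length zs" for a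
      using fin_subgraphsD(5)[of "zs ! a" X] that zs nth_mem[of a zs] by blast
    show "P zs \<subseteq> verts ?Y" "isomorphic (seq_graph (idx X) zs) (induced ?Y (P zs))"
      unfolding P_def by (rule embedding_place[OF strict_mono_rat_of_nat emb]; assumption)+
    show "snd ` P zs = ?e ` {..<length zs}" unfolding P_def using zs by (intro snd_place) auto
    fix a assume a: "a < length zs"
    then have za: "zs ! a \<in> fin_subgraphs X" using zs nth_mem[of a zs] by blast
    show "induced X (sec (P zs) (?e a)) = zs ! a"
      unfolding P_def sec_place[OF strict_mono_rat_of_nat a] by (simp add: fin_subgraphsD(3)[OF za, symmetric])
  qed
  have "isomorphic (induced ?Y (P xs)) (induced ?Y (P ys))"
    by (rule isomorphic_trans[OF isomorphic_trans[OF isomorphic_sym[OF P(2)[OF xs]] iso] P(2)[OF ys]])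
  then obtain f where f: "isomorphism (induced ?Y (P xs)) (induced ?Y (P ys)) f"
    by (auto simp: isomorphic_def)
  obtain h where h: "strict_mono_on (snd ` P xs) h" "\<And>x y. (x, y) \<in> P xs \<Longrightarrow> snd (f (x, y)) = h y"
    "\<And>y. y \<in> snd ` P xs \<Longrightarrow> isomorphism (induced X (sec (P xs) y)) (induced X (sec (P ys) (h y))) (\<lambda>x. fst (f (x, y)))"
    using times_rat_isomorphism[OF P(1)[OF xs] P(1)[OF ys] f] by blast
  have "h ` snd ` P xs = snd ` f ` P xs" using h(2) by (force simp: image_image)
  also have "f ` P xs = P ys" using isomorphism_image[OF f] by simp
  finally have im: "h ` ?e ` {..<length xs} = ?e ` {..<length ys}" using P(3)[OF xs] P(3)[OF ys] by simp
  have mono: "h (?e a) < h (?e b) \<longleftrightarrow> a < b" if "a < length xs" "b < length xs" for a b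
    using h(1) that unfolding P(3)[OF xs] by (subst strict_mono_on_less) auto
  have inj: "inj_on h (?e ` {..<length xs})"
    using strict_mono_on_imp_inj_on[OF h(1)] P(3)[OF xs] by simp
  have h_id: "h (?e a) = ?e a" if a: "a < length xs" for a
  proof -
    obtain b where b: "b < length ys" "h (?e a) = ?e b" using im a by (metis (no_types, lifting) imageE imageI lessThan_iff)
    \<comment> \<open>the heights below \<open>a\<close> correspond to those below \<open>b\<close>, so counting gives \<open>a = b\<close>\<close>
    have "h ` ?e ` {..<a} = ?e ` {..<b}"
    proof (intro equalityI subsetI)
      fix z assume "z \<in> h ` ?e ` {..<a}"
      then obtain c where c: "c < a" "z = h (?e c)" by auto
      then obtain c' where "z = ?e c'" using im a by (metis (no_types, lifting) imageE imageI lessThan_iff less_trans)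
      then show "z \<in> ?e ` {..<b}" using mono[of c a] c a b(2) by auto
    next
      fix z assume "z \<in> ?e ` {..<b}"
      then obtain c where c: "c < b" "z = ?e c" by auto
      then have "z \<in> h ` ?e ` {..<length xs}" using im b(1) by auto
      then obtain c' where "c' < length xs" "z = h (?e c')" by auto
      then show "z \<in> h ` ?e ` {..<a}" using mono[of c' a] c a b(2) by auto
    qed
    then have "card (h ` ?e ` {..<a}) = card (?e ` {..<b})" by simp
    moreover have "card (h ` ?e ` {..<a}) = a"
    proof -
      have "?e ` {..<a} \<subseteq> ?e ` {..<length xs}" using a by (intro image_mono) auto
      then have "inj_on h (?e ` {..<a})" by (rule inj_on_subset[OF inj])
      then show ?thesis by (simp add: card_image)
    qed
    ultimately have "a = b" by (simp add: card_image)
    then show ?thesis using b by simp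
  qed
  have "h ` ?e ` {..<length xs} = ?e ` {..<length xs}" using h_id by (auto simp: image_image)
  then have "card (?e ` {..<length xs}) = card (?e ` {..<length ys})" using im by simp
  then have len: "length xs = length ys" by (simp add: card_image)
  have "isomorphic (xs ! a) (ys ! a)" if a: "a < length xs" for a
  proof -
    have "?e a \<in> snd ` P xs" using a P(3)[OF xs] by auto
    from h(3)[OF this] show ?thesis
      unfolding h_id[OF a] P(4)[OF xs a] P(4)[OF ys a[unfolded len]] by (auto simp: isomorphic_def)
  qed
  then show ?thesis using len by (simp add: list_all2_conv_all_nth)
qed

text \<open>Provides the member that \<open>iso_class_eqD\<close> demands.\<close>

lemma seq_graph_realized:
  assumes "set xs \<subseteq> fin_subgraphs X"
  shows "\<exists>G\<in>fin_subgraphs (times_rat X). isomorphic G (seq_graph (idx X) xs)"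
proof -
  have "embedding (xs ! a) X (\<lambda>v. v)" if "a < length xs" for a
    using fin_subgraphsD(5)[of "xs ! a" X] that assms nth_mem[of a xs] by blast
  note E = embedding_place[OF strict_mono_rat_of_nat this]
  have "finite (place (\<lambda>a v. v) of_nat xs :: ('a \<times> rat) set)"
    using assms fin_subgraphsD(1) by (intro finite_place) auto
  then have "induced (times_rat X) (place (\<lambda>a v. v) of_nat xs) \<in> fin_subgraphs (times_rat X)"
    using E(2) by (intro fin_subgraphsI) auto
  then show ?thesis using E(3) isomorphic_sym by blast
qed

text \<open>The levels of \<open>G\<close>, listed by increasing height and placed back at these
  heights, recover \<open>G\<close>. The bounds on length and size serve oligomorphy of the
  product.\<close>

lemma fin_subgraph_times_rat:
  assumes G: "G \<in> fin_subgraphs (times_rat X)"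
  obtains xs where "set xs \<subseteq> {x \<in> fin_subgraphs X. verts x \<noteq> {} \<and> card (verts x) \<le> card (verts G)}"
    "length xs \<le> card (verts G)" "isomorphic G (seq_graph (idx X) xs)"
proof -
  define S where "S = verts G"
  have S: "finite S" "S \<subseteq> verts (times_rat X)" "G = induced (times_rat X) S"
    using fin_subgraphsD(1-3)[OF G] by (auto simp: S_def)
  define ys where "ys = sorted_list_of_set (snd ` S)"
  define xs where "xs = map (\<lambda>y. induced X (sec S y)) ys"
  have ys: "set ys = snd ` S" "length ys = card (snd ` S)" "sorted_wrt (<) ys"
    using S(1) by (auto simp: ys_def)
  have e: "strict_mono_on {..<length xs} ((!) ys)"
    using ys(3) by (auto simp: strict_mono_on_def sorted_wrt_iff_nth_less xs_def)
  have secS: "finite (sec S y)" "sec S y \<subseteq> verts X" "card (sec S y) \<le> card S" for y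
  proof -
    show "finite (sec S y)" "sec S y \<subseteq> verts X" using S finite_sec by auto
    show "card (sec S y) \<le> card S"
      by (rule card_inj_on_le[of "\<lambda>x. (x, y)"]) (use S in \<open>auto simp: inj_on_def\<close>)
  qed
  have sub: "set xs \<subseteq> {x \<in> fin_subgraphs X. verts x \<noteq> {} \<and> card (verts x) \<le> card S}"
    using secS ys(1) by (force simp: xs_def intro: fin_subgraphsI)
  have "embedding (xs ! a) X (\<lambda>v. v)" if "a < length xs" for a
    using fin_subgraphsD(5)[of "xs ! a" X] that sub nth_mem[of a xs] by blast
  then have "isomorphic (seq_graph (idx X) xs) (induced (times_rat X) (place (\<lambda>a v. v) ((!) ys) xs))"
    by (rule embedding_place(3)[OF e])
  moreover have "place (\<lambda>a v. v) ((!) ys) xs = S"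
  proof (intro equalityI subsetI)
    fix p assume "p \<in> place (\<lambda>a v. v) ((!) ys) xs"
    then show "p \<in> S" by (cases p) (auto simp: in_place xs_def)
  next
    fix p assume p: "p \<in> S"
    then have "snd p \<in> set ys" using ys(1) by auto
    then obtain a where "a < length ys" "ys ! a = snd p" by (auto simp: in_set_conv_nth)
    then show "p \<in> place (\<lambda>a v. v) ((!) ys) xs" using p by (cases p) (auto simp: in_place xs_def)
  qed
  ultimately have "isomorphic G (seq_graph (idx X) xs)" using S(3) isomorphic_sym by metis
  moreover have "length xs \<le> card S" using ys(2) card_image_le[OF S(1)] by (simp add: xs_def)
  ultimately show thesis using that sub by (simp add: S_def)
qed

section \<open>The bijection on isomorphism classes, oligomorphy and the values of the
  measure\<close>

text \<open>A map on classes has to pick representatives; by \<open>isomorphic_seq_graphI\<close>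
  the choice is immaterial.\<close>

definition seq_class :: "('v, 'i) mgraph \<Rightarrow> ('v, 'i) mgraph set list \<Rightarrow> ('v \<times> rat, 'i option) mgraph set" where
  "seq_class X cs = iso_class (times_rat X) (seq_graph (idx X)
     (map (\<lambda>c. SOME x. x \<in> fin_subgraphs X \<and> iso_class X x = c) cs))"

lemma seq_class_map:
  assumes xs: "set xs \<subseteq> fin_subgraphs X"
  shows "seq_class X (map (iso_class X) xs) = iso_class (times_rat X) (seq_graph (idx X) xs)"
proof -
  define r where "r c = (SOME x. x \<in> fin_subgraphs X \<and> iso_class X x = c)" for c
  have r: "isomorphic (r (iso_class X x)) x" if "x \<in> set xs" for x
  proof -
    have "\<exists>z. z \<in> fin_subgraphs X \<and> iso_class X z = iso_class X x" using xs that by auto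
    from someI_ex[OF this] show ?thesis
      unfolding r_def using iso_class_eqD isomorphic_refl by blast
  qed
  have "list_all2 isomorphic (map (\<lambda>x. r (iso_class X x)) xs) xs"
    using r by (simp add: list_all2_conv_all_nth)
  then show ?thesis
    unfolding seq_class_def r_def[symmetric] map_map comp_def
    using isomorphic_seq_graphI[OF _ xs] iso_class_eqI by blast
qed

lemma bij_betw_seq_class:
  "bij_betw (seq_class X) (lists (iso_class X ` {x \<in> fin_subgraphs X. verts x \<noteq> {}}))
     (iso_class (times_rat X) ` fin_subgraphs (times_rat X))"
proof -
  let ?N = "{x \<in> fin_subgraphs X. verts x \<noteq> {}}" and ?Y = "times_rat X"
  have sc: "seq_class X (map (iso_class X) xs) = iso_class ?Y (seq_graph (idx X) xs)" if "xs \<in> lists ?N" for xs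
    using that by (intro seq_class_map) auto
  have "inj_on (seq_class X) (map (iso_class X) ` lists ?N)"
  proof (rule inj_onI)
    fix cs ds assume "cs \<in> map (iso_class X) ` lists ?N" "ds \<in> map (iso_class X) ` lists ?N"
      and cd: "seq_class X cs = seq_class X ds"
    then obtain xs ys where xs: "xs \<in> lists ?N" and ys: "ys \<in> lists ?N"
      and csds: "cs = map (iso_class X) xs" "ds = map (iso_class X) ys" by blast
    have eq: "seq_class X (map (iso_class X) xs) = seq_class X (map (iso_class X) ys)"
      using cd csds by simp
    obtain G where "G \<in> fin_subgraphs ?Y" "isomorphic G (seq_graph (idx X) xs)"
      using seq_graph_realized[of xs X] xs by auto
    then have "isomorphic (seq_graph (idx X) xs) (seq_graph (idx X) ys)"
      using eq sc[OF xs] sc[OF ys] iso_class_eqD by metis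
    then have "list_all2 isomorphic xs ys"
      using isomorphic_seq_graphD xs ys unfolding in_lists_conv_set by blast
    then show "cs = ds"
      unfolding csds
      by (induction rule: list_all2_induct) (simp_all add: iso_class_eqI[of _ _ X])
  qed
  moreover have "seq_class X ` map (iso_class X) ` lists ?N = iso_class ?Y ` fin_subgraphs ?Y"
  proof (intro equalityI subsetI)
    fix c assume "c \<in> seq_class X ` map (iso_class X) ` lists ?N"
    then obtain xs where xs: "xs \<in> lists ?N" "c = iso_class ?Y (seq_graph (idx X) xs)" using sc by auto
    obtain G where "G \<in> fin_subgraphs ?Y" "isomorphic G (seq_graph (idx X) xs)"
      using seq_graph_realized[of xs X] xs by auto
    then show "c \<in> iso_class ?Y ` fin_subgraphs ?Y" using xs(2) iso_class_eqI by blast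
  next
    fix c assume "c \<in> iso_class ?Y ` fin_subgraphs ?Y"
    then obtain G where G: "G \<in> fin_subgraphs ?Y" "c = iso_class ?Y G" by auto
    obtain xs where xs: "set xs \<subseteq> {x \<in> fin_subgraphs X. verts x \<noteq> {} \<and> card (verts x) \<le> card (verts G)}"
      "length xs \<le> card (verts G)" "isomorphic G (seq_graph (idx X) xs)"
      by (rule fin_subgraph_times_rat[OF G(1)])
    then have "xs \<in> lists ?N" "c = seq_class X (map (iso_class X) xs)"
      using sc[of xs] G(2) iso_class_eqI[OF xs(3), of ?Y] by auto
    then show "c \<in> seq_class X ` map (iso_class X) ` lists ?N" by blast
  qed
  ultimately show ?thesis by (simp add: bij_betw_def lists_image)
qed

text \<open>A subgraph with \<open>n\<close> vertices has at most \<open>n\<close> levels of at most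
  \<open>n\<close> vertices each, so its class comes from a list of length at most \<open>n\<close>
  over finitely many classes of \<open>X\<close>.\<close>

lemma homogeneous_oligomorphic_times_rat:
  assumes X: "homogeneous_oligomorphic X"
  shows "homogeneous_oligomorphic (times_rat X)"
  unfolding homogeneous_oligomorphic_def
proof (intro conjI allI)
  let ?Y = "times_rat X"
  have wf: "wf_mgraph X" and hom: "homogeneous X" using X by (auto simp: homogeneous_oligomorphic_def)
  show "wf_mgraph ?Y" using wf unfolding wf_mgraph_def
    by (fastforce simp: times_rat_def)
  show "homogeneous ?Y" using hom by (rule homogeneous_times_rat)
  fix n
  define K where "K = iso_class X ` {G \<in> fin_subgraphs X. card (verts G) \<le> n}"
  have "iso_class ?Y ` {G \<in> fin_subgraphs ?Y. card (verts G) = n} \<subseteq> seq_class X ` {cs. set cs \<subseteq> K \<and> length cs \<le> n}"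
  proof (rule image_subsetI)
    fix G assume G: "G \<in> {G \<in> fin_subgraphs ?Y. card (verts G) = n}"
    then have "G \<in> fin_subgraphs ?Y" by simp
    from fin_subgraph_times_rat[OF this]
    obtain xs where xs: "set xs \<subseteq> {x \<in> fin_subgraphs X. verts x \<noteq> {} \<and> card (verts x) \<le> card (verts G)}"
      "length xs \<le> card (verts G)" "isomorphic G (seq_graph (idx X) xs)"
      .
    have "iso_class ?Y G = seq_class X (map (iso_class X) xs)"
      using iso_class_eqI[OF xs(3)] seq_class_map[of xs X] xs(1) by auto
    moreover have "map (iso_class X) xs \<in> {cs. set cs \<subseteq> K \<and> length cs \<le> n}"
      using xs G by (auto simp: K_def)
    ultimately show "iso_class ?Y G \<in> seq_class X ` {cs. set cs \<subseteq> K \<and> length cs \<le> n}" by blast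
  qed
  moreover have "finite {cs. set cs \<subseteq> K \<and> length cs \<le> n}"
    unfolding K_def using finite_iso_classes_le[OF X] by (rule finite_lists_length_le)
  ultimately show "finite (iso_class ?Y ` {G \<in> fin_subgraphs ?Y. card (verts G) = n})"
    using finite_surj by blast
qed

text \<open>The value is computed on the embedding that puts the \<open>a\<close>-th entry at height
  \<open>a\<close>. As entries are non-empty, exactly \<open>length xs\<close> levels occur, each
  with its own factor -1.\<close>

lemma lex_measure_seq:
  assumes \<nu>: "R_measure X \<nu>" and xs: "set xs \<subseteq> {x \<in> age X. verts x \<noteq> {}}"
    and y: "y \<in> age (times_rat X)" and iso: "isomorphic y (seq_graph (idx X) xs)"
    and m: "set_measure (times_rat X) (lex_measure (\<lambda>T. \<nu> (copy X T)))" and hom: "homogeneous (times_rat X)"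
  shows "pull_measure (times_rat X) (lex_measure (\<lambda>T. \<nu> (copy X T))) y = (-1) ^ length xs * (\<Prod>x\<leftarrow>xs. \<nu> x)"
proof -
  let ?l = "length xs"
  have age: "xs ! a \<in> age X" if "a < ?l" for a using xs that nth_mem[of a xs] by blast
  then have "\<exists>d. embedding (xs ! a) X d" if "a < ?l" for a using that ageD(2) by blast
  then obtain d where d: "\<And>a. a < ?l \<Longrightarrow> embedding (xs ! a) X (d a)" by metis
  let ?e = "of_nat :: nat \<Rightarrow> rat"
  let ?f = "\<lambda>(a, v). (d a v, ?e a)"
  have mono: "strict_mono_on {..<?l} ?e" by (rule strict_mono_rat_of_nat)
  obtain \<phi> where \<phi>: "isomorphism y (seq_graph (idx X) xs) \<phi>" using iso by (auto simp: isomorphic_def)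
  have emb: "embedding y (times_rat X) (\<lambda>v. ?f (\<phi> v))"
    by (rule embedding_comp[OF isomorphism_embedding[OF \<phi>] embedding_place(1)[OF mono d]])
  have "(\<lambda>v. ?f (\<phi> v)) ` verts y = ?f ` \<phi> ` verts y" by (simp only: image_image)
  also have "\<dots> = place d ?e xs" unfolding isomorphism_image[OF \<phi>] by (simp add: place_def)
  finally have "pull_measure (times_rat X) (lex_measure (\<lambda>T. \<nu> (copy X T))) y =
      lex_measure (\<lambda>T. \<nu> (copy X T)) (place d ?e xs)"
    using pull_measure_eq[OF m hom y emb] by simp
  also have "\<dots> = (\<Prod>z\<in>?e ` {..<?l}. - \<nu> (copy X (sec (place d ?e xs) z)))"
    unfolding lex_measure_def using snd_place[of xs d ?e] xs by (intro prod.cong) auto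
  also have "\<dots> = (\<Prod>a<?l. - \<nu> (copy X (sec (place d ?e xs) (?e a))))"
    by (subst prod.reindex) (auto simp: inj_on_def)
  also have "\<dots> = (\<Prod>a<?l. - \<nu> (xs ! a))"
    by (intro prod.cong refl) (simp add: sec_place[OF mono] R_measure_copy[OF \<nu> age d])
  also have "\<dots> = (-1) ^ ?l * (\<Prod>a<?l. \<nu> (xs ! a))"
    using prod.distrib[of "\<lambda>_. -1" "\<lambda>a. \<nu> (xs ! a)" "{..<?l}"] by simp
  also have "(\<Prod>a<?l. \<nu> (xs ! a)) = (\<Prod>x\<leftarrow>xs. \<nu> x)"
    by (simp add: prod.list_conv_set_nth atLeast0LessThan)
  finally show ?thesis .
qed

theorem theoremD:
  fixes X :: "('v, 'i) mgraph"
  assumes "homogeneous_oligomorphic X"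
  shows
    "(\<exists>F. bij_betw F
            (lists (iso_class X ` {x \<in> fin_subgraphs X. verts x \<noteq> {}}))
            (iso_class (times_rat X) ` fin_subgraphs (times_rat X)) \<and>
          (\<forall>xs\<in>lists {x \<in> fin_subgraphs X. verts x \<noteq> {}}.
             F (map (iso_class X) xs) = iso_class (times_rat X) (seq_graph (idx X) xs))) \<and>
     (\<forall>\<nu> :: (nat, 'i) mgraph \<Rightarrow> 'k::field. R_measure X \<nu> \<longrightarrow>
        (\<exists>\<nu>Q :: (nat, 'i option) mgraph \<Rightarrow> 'k. R_measure (times_rat X) \<nu>Q \<and>
           (\<forall>xs\<in>lists {x \<in> age X. verts x \<noteq> {}}. \<forall>y\<in>age (times_rat X).
              isomorphic y (seq_graph (idx X) xs) \<longrightarrow>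
              \<nu>Q y = (-1) ^ length xs * (\<Prod>x\<leftarrow>xs. \<nu> x))))"
proof (intro conjI allI impI)
  show "\<exists>F. bij_betw F (lists (iso_class X ` {x \<in> fin_subgraphs X. verts x \<noteq> {}}))
          (iso_class (times_rat X) ` fin_subgraphs (times_rat X)) \<and>
        (\<forall>xs\<in>lists {x \<in> fin_subgraphs X. verts x \<noteq> {}}.
           F (map (iso_class X) xs) = iso_class (times_rat X) (seq_graph (idx X) xs))"
    by (intro exI[of _ "seq_class X"] conjI ballI bij_betw_seq_class seq_class_map) auto
next
  fix \<nu> :: "(nat, 'i) mgraph \<Rightarrow> 'k" assume \<nu>: "R_measure X \<nu>"
  note Y = homogeneous_oligomorphic_times_rat[OF assms]
  have hom: "homogeneous X" "homogeneous (times_rat X)"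
    using assms Y by (auto simp: homogeneous_oligomorphic_def)
  have m: "set_measure (times_rat X) (lex_measure (\<lambda>T. \<nu> (copy X T)))"
    by (rule set_measure_lex_measure[OF set_measure_of_R_measure[OF \<nu>] hom(1)])
  show "\<exists>\<nu>Q :: (nat, 'i option) mgraph \<Rightarrow> 'k. R_measure (times_rat X) \<nu>Q \<and>
      (\<forall>xs\<in>lists {x \<in> age X. verts x \<noteq> {}}. \<forall>y\<in>age (times_rat X).
         isomorphic y (seq_graph (idx X) xs) \<longrightarrow> \<nu>Q y = (-1) ^ length xs * (\<Prod>x\<leftarrow>xs. \<nu> x))"
    using R_measure_of_set_measure[OF m Y] lex_measure_seq[OF \<nu> _ _ _ m hom(2)]
    by (intro exI[of _ "pull_measure (times_rat X) (lex_measure (\<lambda>T. \<nu> (copy X T)))"]) auto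
qed

end
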